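(* Let $G$ be a lacunary hyperbolic group with property $(\mathrm{F}\mathbb{R})$. Then the outer automorphism group $\mathrm{Out}(G)$ is locally finite, i.e. every finitely generated subgroup of $\mathrm{Out}(G)$ is finite.
   Context: A finitely generated group $G$ is lacunary hyperbolic if at least one of its asymptotic cones is an $\mathbb{R}$-tree (an asymptotic cone of $G$ is an ultralimit, with respect to a non-principal ultrafilter $\omega$ on $\mathbb{N}$, of the pointed metric spaces $(G,\frac{1}{d_n}\mathrm{dist}_S,1)$, where $\mathrm{dist}_S$ is the word metric of a finite generating set $S$ and $d_n\to\infty$). Equivalently (Ol'shanskii–Osin–Sapir), for some finite generating set $S$, $(G,S)$ is the direct limit of a sequence of groups with finite generating sets and epimorphisms $\alpha_k\colon (G_k,S_k)\to(G_{k+1},S_{k+1})$, $k\in\mathbb{N}$, with $\alpha_k(S_k)=S_{k+1}$, such that the Cayley graph of $G_k$ with respect to $S_k$ is $\delta_k$-hyperbolic ($\delta_k>0$; every side of a geodesic triangle lies in the $\delta_k$-neighbourhood of the union of the other two) and $\mathrm{inj}(\eta_k)/\delta_k\to\infty$. Here $\eta_k\colon G_k\to G$ is the natural epimorphism and $\mathrm{inj}(\eta_k)\in\mathbb{N}\cup\{\infty\}$ is the largest $R$ such that $\eta_k$ is injective on every ball of radius $R$ of $G_k$ for the word metric of $S_k$. A group $G$ has property $(\mathrm{F}\mathbb{R})$ if every action of $G$ by isometries on an $\mathbb{R}$-tree has a global fixed point. *)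

theory Defs
  imports "HOL-Analysis.Analysis" "HOL-Algebra.Group_Action" "HOL-Algebra.Generated_Groups"
begin

section \<open>Real trees\<close>

definition geodesic_segment :: "'a set \<Rightarrow> ('a \<Rightarrow> 'a \<Rightarrow> real) \<Rightarrow> 'a \<Rightarrow> 'a \<Rightarrow> 'a set \<Rightarrow> bool"
  where "geodesic_segment T d x y s \<longleftrightarrow>
    (\<exists>\<gamma> :: real \<Rightarrow> 'a.
       \<gamma> ` {0..d x y} \<subseteq> T \<and>
       (\<forall>a\<in>{0..d x y}. \<forall>b\<in>{0..d x y}. d (\<gamma> a) (\<gamma> b) = \<bar>a - b\<bar>) \<and>
       \<gamma> 0 = x \<and> \<gamma> (d x y) = y \<and> s = \<gamma> ` {0..d x y})"

text \<open>
  The definition of Bridson and Haefliger (Chapter III.H). The empty space is excluded: otherwise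
  no group could have a global fixed point in every real tree it acts on.
\<close>

definition real_tree :: "'a set \<Rightarrow> ('a \<Rightarrow> 'a \<Rightarrow> real) \<Rightarrow> bool"
  where "real_tree T d \<longleftrightarrow>
    Metric_space T d \<and> T \<noteq> {} \<and>
    (\<forall>x\<in>T. \<forall>y\<in>T. \<exists>!s. geodesic_segment T d x y s) \<and>
    (\<forall>x\<in>T. \<forall>y\<in>T. \<forall>z\<in>T. \<forall>s t.
       geodesic_segment T d y x s \<and> geodesic_segment T d x z t \<and> s \<inter> t = {x} \<longrightarrow>
       geodesic_segment T d y z (s \<union> t))"

section \<open>Property FR\<close>

text \<open>
  HOL cannot quantify over the type of the points of the tree inside a formula, so the trees here
  live on subsets of \<open>'a \<times> real\<close>, where \<open>'a\<close> is the type of the group elements. This is no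
  restriction, because the union of the segments from a point \<open>x\<close> to the points of its orbit is an
  invariant subtree, and a point of it is determined by some \<open>h\<close> for which it lies on the segment
  from \<open>x\<close> to \<open>h x\<close> together with its distance from \<open>x\<close>. Lemma \<open>property_FR_fixed_point\<close>
  below gives the fixed point for trees on an arbitrary type.
\<close>

definition property_FR :: "('a, 'm) monoid_scheme \<Rightarrow> bool"
  where "property_FR G \<longleftrightarrow>
    (\<forall>(T :: ('a \<times> real) set) d \<phi>.
       real_tree T d \<and> group_action G T \<phi> \<and>
       (\<forall>g\<in>carrier G. \<forall>x\<in>T. \<forall>y\<in>T. d (\<phi> g x) (\<phi> g y) = d x y) \<longrightarrow>
       (\<exists>x\<in>T. \<forall>g\<in>carrier G. \<phi> g x = x))"

section \<open>Word metrics\<close>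

definition finite_generating_set :: "('a, 'm) monoid_scheme \<Rightarrow> 'a set \<Rightarrow> bool"
  where "finite_generating_set G S \<longleftrightarrow> finite S \<and> S \<subseteq> carrier G \<and> generate G S = carrier G"

definition finitely_generated_group :: "('a, 'm) monoid_scheme \<Rightarrow> bool"
  where "finitely_generated_group G \<longleftrightarrow> (\<exists>S. finite_generating_set G S)"

definition word_length :: "('a, 'm) monoid_scheme \<Rightarrow> 'a set \<Rightarrow> 'a \<Rightarrow> nat"
  where "word_length G S g =
    (LEAST n. \<exists>ws. length ws = n \<and> set ws \<subseteq> S \<union> (\<lambda>s. inv\<^bsub>G\<^esub> s) ` S \<and>
                   foldr (\<lambda>a b. a \<otimes>\<^bsub>G\<^esub> b) ws \<one>\<^bsub>G\<^esub> = g)"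

text \<open>
  The locale \<^locale>\<open>Metric_space\<close> wants nonnegativity and symmetry also outside the carrier; hence
  the value 0 there, here and in \<open>ultralimit_dist\<close>.
\<close>

definition word_dist :: "('a, 'm) monoid_scheme \<Rightarrow> 'a set \<Rightarrow> 'a \<Rightarrow> 'a \<Rightarrow> real"
  where "word_dist G S g h =
    (if g \<in> carrier G \<and> h \<in> carrier G then real (word_length G S (inv\<^bsub>G\<^esub> g \<otimes>\<^bsub>G\<^esub> h)) else 0)"

section \<open>Ultralimits and asymptotic cones\<close>

definition nonprincipal_ultrafilter :: "nat filter \<Rightarrow> bool"
  where "nonprincipal_ultrafilter \<omega> \<longleftrightarrow>
    \<omega> \<noteq> bot \<and>
    (\<forall>P. eventually P \<omega> \<or> eventually (\<lambda>n. \<not> P n) \<omega>) \<and>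
    (\<forall>m. eventually (\<lambda>n. n \<noteq> m) \<omega>)"

definition ultralimit_seqs ::
    "(nat \<Rightarrow> 'a set) \<Rightarrow> (nat \<Rightarrow> 'a \<Rightarrow> 'a \<Rightarrow> real) \<Rightarrow> (nat \<Rightarrow> 'a) \<Rightarrow> (nat \<Rightarrow> 'a) set"
  where "ultralimit_seqs X D p =
    {x. (\<forall>n. x n \<in> X n) \<and> (\<exists>C. \<forall>n. D n (p n) (x n) \<le> C)}"

definition ultralimit_rel ::
    "nat filter \<Rightarrow> (nat \<Rightarrow> 'a set) \<Rightarrow> (nat \<Rightarrow> 'a \<Rightarrow> 'a \<Rightarrow> real) \<Rightarrow> (nat \<Rightarrow> 'a) \<Rightarrow>
     ((nat \<Rightarrow> 'a) \<times> (nat \<Rightarrow> 'a)) set"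
  where "ultralimit_rel \<omega> X D p =
    {(x, y). x \<in> ultralimit_seqs X D p \<and> y \<in> ultralimit_seqs X D p \<and>
             ((\<lambda>n. D n (x n) (y n)) \<longlongrightarrow> 0) \<omega>}"

definition ultralimit ::
    "nat filter \<Rightarrow> (nat \<Rightarrow> 'a set) \<Rightarrow> (nat \<Rightarrow> 'a \<Rightarrow> 'a \<Rightarrow> real) \<Rightarrow> (nat \<Rightarrow> 'a) \<Rightarrow>
     (nat \<Rightarrow> 'a) set set"
  where "ultralimit \<omega> X D p = ultralimit_seqs X D p // ultralimit_rel \<omega> X D p"

definition ultralimit_dist ::
    "nat filter \<Rightarrow> (nat \<Rightarrow> 'a set) \<Rightarrow> (nat \<Rightarrow> 'a \<Rightarrow> 'a \<Rightarrow> real) \<Rightarrow> (nat \<Rightarrow> 'a) \<Rightarrow>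
     (nat \<Rightarrow> 'a) set \<Rightarrow> (nat \<Rightarrow> 'a) set \<Rightarrow> real"
  where "ultralimit_dist \<omega> X D p A B =
    (if A \<in> ultralimit \<omega> X D p \<and> B \<in> ultralimit \<omega> X D p
     then Lim \<omega> (\<lambda>n. D n ((SOME x. x \<in> A) n) ((SOME y. y \<in> B) n)) else 0)"

definition asymptotic_cone ::
    "('a, 'm) monoid_scheme \<Rightarrow> 'a set \<Rightarrow> nat filter \<Rightarrow> (nat \<Rightarrow> real) \<Rightarrow> (nat \<Rightarrow> 'a) set set"
  where "asymptotic_cone G S \<omega> d =
    ultralimit \<omega> (\<lambda>n. carrier G) (\<lambda>n g h. word_dist G S g h / d n) (\<lambda>n. \<one>\<^bsub>G\<^esub>)"

definition asymptotic_cone_dist ::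
    "('a, 'm) monoid_scheme \<Rightarrow> 'a set \<Rightarrow> nat filter \<Rightarrow> (nat \<Rightarrow> real) \<Rightarrow>
     (nat \<Rightarrow> 'a) set \<Rightarrow> (nat \<Rightarrow> 'a) set \<Rightarrow> real"
  where "asymptotic_cone_dist G S \<omega> d =
    ultralimit_dist \<omega> (\<lambda>n. carrier G) (\<lambda>n g h. word_dist G S g h / d n) (\<lambda>n. \<one>\<^bsub>G\<^esub>)"

definition lacunary_hyperbolic :: "('a, 'm) monoid_scheme \<Rightarrow> bool"
  where "lacunary_hyperbolic G \<longleftrightarrow>
    (\<exists>S \<omega> d. finite_generating_set G S \<and> nonprincipal_ultrafilter \<omega> \<and>
             (\<forall>n. d n > 0) \<and> filterlim d at_top sequentially \<and>
             real_tree (asymptotic_cone G S \<omega> d) (asymptotic_cone_dist G S \<omega> d))"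

section \<open>Outer automorphisms and local finiteness\<close>

definition inner_automorphisms :: "('a, 'm) monoid_scheme \<Rightarrow> ('a \<Rightarrow> 'a) set"
  where "inner_automorphisms G =
    (\<lambda>g. \<lambda>x\<in>carrier G. g \<otimes>\<^bsub>G\<^esub> x \<otimes>\<^bsub>G\<^esub> inv\<^bsub>G\<^esub> g) ` carrier G"

definition Out :: "('a, 'm) monoid_scheme \<Rightarrow> ('a \<Rightarrow> 'a) set monoid"
  where "Out G = AutoGroup G Mod inner_automorphisms G"

definition locally_finite_group :: "('a, 'm) monoid_scheme \<Rightarrow> bool"
  where "locally_finite_group H \<longleftrightarrow>
    (\<forall>K. subgroup K H \<and> finitely_generated_group (H\<lparr>carrier := K\<rparr>) \<longrightarrow> finite K)"

section \<open>The quotient \<open>Out\<close> is a group\<close>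

lemma AutoGroup_simps:
  "carrier (AutoGroup G) = auto G"
  "\<lbrakk>f \<in> auto G; h \<in> auto G\<rbrakk> \<Longrightarrow> f \<otimes>\<^bsub>AutoGroup G\<^esub> h = compose (carrier G) f h"
  "\<one>\<^bsub>AutoGroup G\<^esub> = (\<lambda>x\<in>carrier G. x)"
  by (auto simp: AutoGroup_def BijGroup_def auto_def)

context group
begin

lemma inner_automorphism_in_auto:
  assumes g: "g \<in> carrier G"
  shows "(\<lambda>x\<in>carrier G. g \<otimes> x \<otimes> inv g) \<in> auto G"
proof -
  let ?c = "\<lambda>x\<in>carrier G. g \<otimes> x \<otimes> inv g"
  have "?c \<in> hom G G"
  proof (rule homI)
    fix x y assume "x \<in> carrier G" "y \<in> carrier G"
    with g show "?c (x \<otimes> y) = ?c x \<otimes> ?c y"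
      by (simp add: m_assoc inv_solve_left)
  qed (use g in simp)
  moreover have "bij_betw ?c (carrier G) (carrier G)"
    by (rule bij_betw_byWitness[where f' = "\<lambda>x. inv g \<otimes> x \<otimes> g"])
      (use g in \<open>auto simp: m_assoc[symmetric] inv_solve_right'[symmetric]\<close>;
       use g in \<open>simp add: m_assoc\<close>)+
  ultimately show ?thesis by (auto simp: auto_def Bij_def)
qed

lemma inner_automorphisms_normal: "inner_automorphisms G \<lhd> AutoGroup G"
proof -
  let ?c = "\<lambda>g. \<lambda>x\<in>carrier G. g \<otimes> x \<otimes> inv g"
  interpret A: group "AutoGroup G" by (rule AutoGroup)
  have h: "?c \<in> hom G (AutoGroup G)"
  proof (rule homI)
    fix g h assume "g \<in> carrier G" "h \<in> carrier G"
    then show "?c (g \<otimes> h) = ?c g \<otimes>\<^bsub>AutoGroup G\<^esub> ?c h"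
      by (auto simp: AutoGroup_simps inner_automorphism_in_auto compose_def fun_eq_iff m_assoc
          inv_mult_group)
  qed (simp add: AutoGroup_simps inner_automorphism_in_auto)
  have sub: "subgroup (inner_automorphisms G) (AutoGroup G)"
    unfolding inner_automorphisms_def
    using group_hom.img_is_subgroup[of G "AutoGroup G" ?c] h
    by (simp add: group_hom_def group_hom_axioms_def A.is_group is_group)
  show ?thesis
  proof (rule A.normal_invI[OF sub])
    fix f i assume f: "f \<in> carrier (AutoGroup G)" and i: "i \<in> inner_automorphisms G"
    obtain g where g: "g \<in> carrier G" "i = ?c g"
      using i by (auto simp: inner_automorphisms_def)
    have fa: "f \<in> auto G" using f by (simp add: AutoGroup_simps)
    then have fh: "f \<in> hom G G" and fb: "f \<in> Bij (carrier G)" by (auto simp: auto_def)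
    have fc: "f x \<in> carrier G" if "x \<in> carrier G" for x using fh that by (auto simp: hom_def)
    have eq: "f \<otimes>\<^bsub>AutoGroup G\<^esub> i = ?c (f g) \<otimes>\<^bsub>AutoGroup G\<^esub> f"
    proof -
      interpret F: group_hom G G f using fh by unfold_locales
      show ?thesis
        unfolding g(2) using g(1) fa fc by (auto simp: AutoGroup_simps inner_automorphism_in_auto compose_def fun_eq_iff)
    qed
    have c: "?c (f g) \<in> carrier (AutoGroup G)"
      using fc g by (simp add: AutoGroup_simps inner_automorphism_in_auto)
    have "f \<otimes>\<^bsub>AutoGroup G\<^esub> i \<otimes>\<^bsub>AutoGroup G\<^esub> inv\<^bsub>AutoGroup G\<^esub> f = ?c (f g)"
      unfolding eq using c f by (simp add: A.m_assoc)
    then show "f \<otimes>\<^bsub>AutoGroup G\<^esub> i \<otimes>\<^bsub>AutoGroup G\<^esub> inv\<^bsub>AutoGroup G\<^esub> f \<in> inner_automorphisms G"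
      using fc g by (auto simp: inner_automorphisms_def)
  qed
qed

lemma group_Out: "group (Out G)"
  unfolding Out_def by (rule normal.factorgroup_is_group[OF inner_automorphisms_normal])

end

section \<open>Ultralimits are metric spaces\<close>

lemma nonprincipal_ultrafilter_bounded_convergent:
  fixes f :: "nat \<Rightarrow> real"
  assumes \<omega>: "nonprincipal_ultrafilter \<omega>" and C: "\<And>n. \<bar>f n\<bar> \<le> C"
  shows "(f \<longlongrightarrow> Lim \<omega> f) \<omega>"
proof -
  have nb: "\<omega> \<noteq> bot" and u: "\<And>P. eventually P \<omega> \<or> eventually (\<lambda>n. \<not> P n) \<omega>"
    using \<omega> by (auto simp: nonprincipal_ultrafilter_def)
  have "\<exists>l\<in>cball 0 C. inf (nhds l) (filtermap f \<omega>) \<noteq> bot"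
    by (rule compact_filter[THEN iffD1, rule_format, OF compact_cball])
      (use C nb in \<open>auto simp: filtermap_bot_iff eventually_filtermap\<close>)
  then obtain l where l: "inf (nhds l) (filtermap f \<omega>) \<noteq> bot" by blast
  have "(f \<longlongrightarrow> l) \<omega>"
  proof (rule topological_tendstoI)
    fix U assume U: "open U" "l \<in> U"
    show "eventually (\<lambda>n. f n \<in> U) \<omega>"
    proof (rule ccontr)
      assume "\<not> eventually (\<lambda>n. f n \<in> U) \<omega>"
      then have "eventually (\<lambda>n. f n \<notin> U) \<omega>" using u by blast
      then have "eventually (\<lambda>x. x \<notin> U) (filtermap f \<omega>)" by (simp add: eventually_filtermap)
      moreover have "eventually (\<lambda>x. x \<in> U) (nhds l)" using U by (rule eventually_nhds_in_open)
      ultimately have "eventually (\<lambda>x. False) (inf (nhds l) (filtermap f \<omega>))"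
        unfolding eventually_inf by blast
      then show False using l by (simp add: trivial_limit_def)
    qed
  qed
  then show ?thesis using tendsto_Lim[OF nb] by metis
qed

locale pointed_metric_sequence =
  fixes \<omega> :: "nat filter" and X :: "nat \<Rightarrow> 'a set" and D p
  assumes ultrafilter: "nonprincipal_ultrafilter \<omega>"
    and metric: "\<And>n. Metric_space (X n) (D n)"
    and base: "\<And>n. p n \<in> X n"
begin

abbreviation (input) "Q \<equiv> ultralimit_seqs X D p"
abbreviation (input) "R \<equiv> ultralimit_rel \<omega> X D p"
abbreviation (input) "L \<equiv> ultralimit \<omega> X D p"

lemma not_bot: "\<omega> \<noteq> bot"
  using ultrafilter by (simp add: nonprincipal_ultrafilter_def)

lemma in_X: "x \<in> Q \<Longrightarrow> x n \<in> X n"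
  by (simp add: ultralimit_seqs_def)

lemma tri: "\<lbrakk>x \<in> Q; y \<in> Q; z \<in> Q\<rbrakk> \<Longrightarrow> D n (x n) (z n) \<le> D n (x n) (y n) + D n (y n) (z n)"
  using metric[of n] in_X by (intro Metric_space.triangle) auto

lemma nonneg: "0 \<le> D n a b"
  using metric by (rule Metric_space.nonneg)

lemma commute: "D n a b = D n b a"
  using metric by (rule Metric_space.commute)

lemma D_self: "a \<in> X n \<Longrightarrow> D n a a = 0"
  using Metric_space.zero[OF metric, of a n a] by simp

lemma base_in: "p \<in> Q"
  using base by (auto simp: ultralimit_seqs_def D_self intro!: exI[of _ 0])

lemma dist_tendsto:
  assumes "x \<in> Q" "y \<in> Q"
  shows "((\<lambda>n. D n (x n) (y n)) \<longlongrightarrow> Lim \<omega> (\<lambda>n. D n (x n) (y n))) \<omega>"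
proof -
  obtain C1 C2 where C: "\<And>n. D n (p n) (x n) \<le> C1" "\<And>n. D n (p n) (y n) \<le> C2"
    using assms by (auto simp: ultralimit_seqs_def)
  have "\<bar>D n (x n) (y n)\<bar> \<le> C1 + C2" for n
    using tri[OF assms(1) base_in assms(2), of n] C[of n] commute[of n "x n" "p n"]
      nonneg[of n "x n" "y n"] by linarith
  then show ?thesis by (rule nonprincipal_ultrafilter_bounded_convergent[OF ultrafilter])
qed

lemma equiv_R: "equiv Q R"
proof (rule equivI)
  show "R \<subseteq> Q \<times> Q" by (auto simp: ultralimit_rel_def)
  show "refl_on Q R"
    by (auto simp: refl_on_def ultralimit_rel_def in_X D_self)
  show "sym R" by (auto simp: sym_def ultralimit_rel_def commute)
  show "trans R"
  proof (rule transI)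
    fix x y z assume xy: "(x, y) \<in> R" and yz: "(y, z) \<in> R"
    then have q: "x \<in> Q" "y \<in> Q" "z \<in> Q" by (auto simp: ultralimit_rel_def)
    have "((\<lambda>n. D n (x n) (y n) + D n (y n) (z n)) \<longlongrightarrow> 0 + 0) \<omega>"
      using xy yz by (intro tendsto_add) (auto simp: ultralimit_rel_def)
    then have "((\<lambda>n. D n (x n) (y n) + D n (y n) (z n)) \<longlongrightarrow> 0) \<omega>" by simp
    then have "((\<lambda>n. D n (x n) (z n)) \<longlongrightarrow> 0) \<omega>"
      by (rule tendsto_sandwich[OF always_eventually always_eventually tendsto_const, rotated 2])
        (use tri[OF q] nonneg in blast)+
    then show "(x, z) \<in> R" using q by (simp add: ultralimit_rel_def)
  qed
qed

lemma Lim_le_cong: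
  assumes "(x, x') \<in> R" "(y, y') \<in> R"
  shows "Lim \<omega> (\<lambda>n. D n (x n) (y n)) \<le> Lim \<omega> (\<lambda>n. D n (x' n) (y' n))"
proof -
  have q: "x \<in> Q" "y \<in> Q" "x' \<in> Q" "y' \<in> Q" using assms by (auto simp: ultralimit_rel_def)
  have "((\<lambda>n. D n (x n) (x' n) + D n (x' n) (y' n) + D n (y n) (y' n))
      \<longlongrightarrow> 0 + Lim \<omega> (\<lambda>n. D n (x' n) (y' n)) + 0) \<omega>"
    using assms dist_tendsto[OF q(3,4)] by (intro tendsto_add) (auto simp: ultralimit_rel_def)
  moreover have "D n (x n) (y n) \<le> D n (x n) (x' n) + D n (x' n) (y' n) + D n (y n) (y' n)" for n
    using tri[OF q(1,3,2), of n] tri[OF q(3,4,2), of n] commute[of n "y' n" "y n"] by linarith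
  ultimately show ?thesis
    using tendsto_le[OF not_bot _ dist_tendsto[OF q(1,2)]] by fastforce
qed

lemma in_class_iff:
  assumes "A \<in> L" "B \<in> L" "x \<in> A" "y \<in> B"
  shows "(x, y) \<in> R \<longleftrightarrow> A = B"
  using quotient_eq_iff[OF equiv_R] assms unfolding ultralimit_def by blast

text \<open>The choice of representatives in \<^const>\<open>ultralimit_dist\<close> is irrelevant.\<close>

lemma ultralimit_dist_eq:
  assumes "A \<in> L" "B \<in> L" "x \<in> A" "y \<in> B"
  shows "ultralimit_dist \<omega> X D p A B = Lim \<omega> (\<lambda>n. D n (x n) (y n))"
proof -
  let ?x = "SOME x. x \<in> A" and ?y = "SOME y. y \<in> B"
  have "?x \<in> A" "?y \<in> B" using assms someI[of "\<lambda>x. x \<in> A"] someI[of "\<lambda>y. y \<in> B"] by auto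
  then have "(x, ?x) \<in> R" "(?x, x) \<in> R" "(y, ?y) \<in> R" "(?y, y) \<in> R"
    using in_class_iff[OF assms(1,1,3)] in_class_iff[OF assms(1,1) _ assms(3)]
      in_class_iff[OF assms(2,2,4)] in_class_iff[OF assms(2,2) _ assms(4)] by simp_all
  then have "Lim \<omega> (\<lambda>n. D n (?x n) (?y n)) = Lim \<omega> (\<lambda>n. D n (x n) (y n))"
    by (intro antisym Lim_le_cong)
  then show ?thesis
    using assms(1,2) by (simp add: ultralimit_dist_def)
qed

lemma ultralimit_nonempty: "A \<in> L \<Longrightarrow> \<exists>x. x \<in> A \<and> x \<in> Q"
  unfolding ultralimit_def
  by (elim quotientE) (use equiv_class_self[OF equiv_R] in blast)

theorem Metric_space_ultralimit: "Metric_space L (ultralimit_dist \<omega> X D p)"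
proof -
  let ?d = "ultralimit_dist \<omega> X D p"
  obtain r where r: "\<And>A. A \<in> L \<Longrightarrow> r A \<in> A \<and> r A \<in> Q"
    using ultralimit_nonempty by metis
  have d: "?d A B = Lim \<omega> (\<lambda>n. D n (r A n) (r B n))" if "A \<in> L" "B \<in> L" for A B
    using that r ultralimit_dist_eq by blast
  have lim: "((\<lambda>n. D n (r A n) (r B n)) \<longlongrightarrow> ?d A B) \<omega>" if "A \<in> L" "B \<in> L" for A B
    using dist_tendsto d r that by metis
  show ?thesis
  proof
    fix A B
    show "0 \<le> ?d A B"
    proof (cases "A \<in> L \<and> B \<in> L")
      case True
      then show ?thesis by (intro tendsto_lowerbound[OF lim _ not_bot]) (auto simp: nonneg)
    qed (auto simp: ultralimit_dist_def)
    show "?d A B = ?d B A"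
    proof (cases "A \<in> L \<and> B \<in> L")
      case True
      then show ?thesis by (simp add: d commute)
    qed (auto simp: ultralimit_dist_def)
  next
    fix A B assume AB: "A \<in> L" "B \<in> L"
    have "?d A B = 0 \<longleftrightarrow> (r A, r B) \<in> R"
    proof
      assume "?d A B = 0"
      then show "(r A, r B) \<in> R" using lim[OF AB] r AB by (simp add: ultralimit_rel_def)
    next
      assume "(r A, r B) \<in> R"
      then have "((\<lambda>n. D n (r A n) (r B n)) \<longlongrightarrow> 0) \<omega>" by (simp add: ultralimit_rel_def)
      then show "?d A B = 0" by (rule tendsto_unique[OF not_bot lim[OF AB]])
    qed
    also have "\<dots> \<longleftrightarrow> A = B"
      using AB r in_class_iff by blast
    finally show "?d A B = 0 \<longleftrightarrow> A = B" .
  next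
    fix A B C assume "A \<in> L" "B \<in> L" "C \<in> L"
    then show "?d A C \<le> ?d A B + ?d B C"
      by (intro tendsto_le[OF not_bot tendsto_add[OF lim lim] lim] always_eventually allI tri)
        (simp_all add: r)
  qed
qed

end

section \<open>Asymptotic cones are metric spaces\<close>

lemma word_length_eqI:
  assumes "length ws = n" "set ws \<subseteq> S \<union> (\<lambda>s. inv\<^bsub>G\<^esub> s) ` S"
    "foldr (\<lambda>a b. a \<otimes>\<^bsub>G\<^esub> b) ws \<one>\<^bsub>G\<^esub> = g"
  shows "word_length G S g \<le> n"
  unfolding word_length_def by (rule Least_le) (use assms in blast)

context group
begin

lemma word_prod_closed:
  "\<lbrakk>S \<subseteq> carrier G; set ws \<subseteq> S \<union> (\<lambda>s. inv s) ` S\<rbrakk> \<Longrightarrow> foldr (\<lambda>a b. a \<otimes> b) ws \<one> \<in> carrier G"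
  by (induction ws) auto

lemma word_prod_append:
  "\<lbrakk>S \<subseteq> carrier G; set us \<subseteq> S \<union> (\<lambda>s. inv s) ` S; set ws \<subseteq> S \<union> (\<lambda>s. inv s) ` S\<rbrakk> \<Longrightarrow>
   foldr (\<lambda>a b. a \<otimes> b) (us @ ws) \<one> = foldr (\<lambda>a b. a \<otimes> b) us \<one> \<otimes> foldr (\<lambda>a b. a \<otimes> b) ws \<one>"
proof (induction us)
  case Nil
  then show ?case using word_prod_closed[of S ws] by simp
next
  case (Cons u us)
  then have "u \<in> carrier G" by auto
  with Cons word_prod_closed[of S us] word_prod_closed[of S ws] show ?case by (simp add: m_assoc)
qed

lemma word_prod_inv:
  "\<lbrakk>S \<subseteq> carrier G; set ws \<subseteq> S \<union> (\<lambda>s. inv s) ` S\<rbrakk> \<Longrightarrow>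
   foldr (\<lambda>a b. a \<otimes> b) (rev (map (\<lambda>s. inv s) ws)) \<one> = inv (foldr (\<lambda>a b. a \<otimes> b) ws \<one>)
   \<and> set (rev (map (\<lambda>s. inv s) ws)) \<subseteq> S \<union> (\<lambda>s. inv s) ` S"
proof (induction ws)
  case (Cons w ws)
  let ?r = "rev (map (\<lambda>s. inv s) ws)"
  have SG: "S \<subseteq> carrier G" and ws: "set ws \<subseteq> S \<union> (\<lambda>s. inv s) ` S" using Cons.prems by simp_all
  have "w \<in> S \<or> (\<exists>s\<in>S. w = inv s)" using Cons.prems by auto
  then have w: "w \<in> carrier G \<and> inv w \<in> S \<union> (\<lambda>s. inv s) ` S"
  proof (elim disjE bexE)
    fix s assume "s \<in> S" "w = inv s"
    then show ?thesis using subsetD[OF SG, of s] by simp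
  qed (use SG in blast)
  have IH: "foldr (\<lambda>a b. a \<otimes> b) ?r \<one> = inv (foldr (\<lambda>a b. a \<otimes> b) ws \<one>)"
    "set ?r \<subseteq> S \<union> (\<lambda>s. inv s) ` S" using Cons.IH[OF SG ws] by blast+
  have "foldr (\<lambda>a b. a \<otimes> b) (?r @ [inv w]) \<one> =
      foldr (\<lambda>a b. a \<otimes> b) ?r \<one> \<otimes> foldr (\<lambda>a b. a \<otimes> b) [inv w] \<one>"
    by (rule word_prod_append[OF SG IH(2)]) (use w in simp)
  also have "\<dots> = inv (foldr (\<lambda>a b. a \<otimes> b) (w # ws) \<one>)"
    using w word_prod_closed[OF SG ws] by (simp only: IH(1)) (simp add: inv_mult_group)
  finally show ?case using IH(2) w by (simp del: foldr_append)
qed simp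

lemma word_length_word:
  assumes S: "finite_generating_set G S" and g: "g \<in> carrier G"
  obtains ws where "length ws = word_length G S g" "set ws \<subseteq> S \<union> (\<lambda>s. inv s) ` S"
    "foldr (\<lambda>a b. a \<otimes> b) ws \<one> = g"
proof -
  have SG: "S \<subseteq> carrier G" using S by (simp add: finite_generating_set_def)
  let ?W = "\<lambda>ws g. set ws \<subseteq> S \<union> (\<lambda>s. inv s) ` S \<and> foldr (\<lambda>a b. a \<otimes> b) ws \<one> = g"
  have "g \<in> generate G S" using S g by (simp add: finite_generating_set_def)
  then have "\<exists>ws. ?W ws g"
  proof induction
    case one
    show ?case by (rule exI[of _ "[]"]) simp
  next
    case (incl h)
    then show ?case using SG by (intro exI[of _ "[h]"]) auto
  next
    case (inv h)
    then show ?case using SG by (intro exI[of _ "[inv h]"]) auto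
  next
    case (eng h1 h2)
    then obtain us ws where "?W us h1" "?W ws h2" by blast
    then show ?case using SG by (intro exI[of _ "us @ ws"]) (simp add: word_prod_append del: foldr_append)
  qed
  then have "\<exists>n ws. length ws = n \<and> ?W ws g" by blast
  then have "\<exists>ws. length ws = word_length G S g \<and> ?W ws g"
    unfolding word_length_def by (rule LeastI_ex)
  then show ?thesis using that by blast
qed

lemma Metric_space_word_dist:
  assumes S: "finite_generating_set G S"
  shows "Metric_space (carrier G) (word_dist G S)"
proof -
  have SG: "S \<subseteq> carrier G" using S by (simp add: finite_generating_set_def)
  have inv_le: "word_length G S (inv g) \<le> word_length G S g" if g: "g \<in> carrier G" for g
  proof -
    obtain ws where "length ws = word_length G S g" "set ws \<subseteq> S \<union> (\<lambda>s. inv s) ` S"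
      "foldr (\<lambda>a b. a \<otimes> b) ws \<one> = g" using word_length_word[OF S g] .
    then show ?thesis
      using word_prod_inv[OF SG, of ws] by (intro word_length_eqI[of "rev (map (\<lambda>s. inv s) ws)"]) auto
  qed
  have mult_le: "word_length G S (g \<otimes> h) \<le> word_length G S g + word_length G S h"
    if g: "g \<in> carrier G" and h: "h \<in> carrier G" for g h
  proof -
    obtain us where "length us = word_length G S g" "set us \<subseteq> S \<union> (\<lambda>s. inv s) ` S"
      "foldr (\<lambda>a b. a \<otimes> b) us \<one> = g" using word_length_word[OF S g] .
    moreover obtain ws where "length ws = word_length G S h" "set ws \<subseteq> S \<union> (\<lambda>s. inv s) ` S"
      "foldr (\<lambda>a b. a \<otimes> b) ws \<one> = h" using word_length_word[OF S h] .
    ultimately show ?thesis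
      using SG by (intro word_length_eqI[of "us @ ws"]) (simp_all add: word_prod_append del: foldr_append)
  qed
  have zero: "word_length G S g = 0 \<longleftrightarrow> g = \<one>" if g: "g \<in> carrier G" for g
  proof
    obtain ws where ws: "length ws = word_length G S g" "foldr (\<lambda>a b. a \<otimes> b) ws \<one> = g"
      using word_length_word[OF S g] .
    then show "g = \<one>" if "word_length G S g = 0" using that by simp
    show "word_length G S g = 0" if "g = \<one>"
      using word_length_eqI[of "[]" 0 S G g] that by simp
  qed
  have sym_le: "word_dist G S g h \<le> word_dist G S h g" for g h
  proof (cases "g \<in> carrier G \<and> h \<in> carrier G")
    case True
    then show ?thesis using inv_le[of "inv h \<otimes> g"] by (simp add: word_dist_def inv_mult_group)
  qed (auto simp: word_dist_def)
  show ?thesis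
  proof
    fix g h
    show "0 \<le> word_dist G S g h" by (simp add: word_dist_def)
    show "word_dist G S g h = word_dist G S h g" using sym_le by (intro antisym)
  next
    fix g h assume gh: "g \<in> carrier G" "h \<in> carrier G"
    then have "word_dist G S g h = 0 \<longleftrightarrow> inv g \<otimes> h = \<one>" by (simp add: word_dist_def zero)
    also have "\<dots> \<longleftrightarrow> g = h" using inv_solve_left[of \<one> g h] gh by auto
    finally show "word_dist G S g h = 0 \<longleftrightarrow> g = h" .
  next
    fix g h k assume ghk: "g \<in> carrier G" "h \<in> carrier G" "k \<in> carrier G"
    then have "h \<otimes> (inv h \<otimes> k) = k" by (simp add: m_assoc[symmetric])
    then have "inv g \<otimes> k = (inv g \<otimes> h) \<otimes> (inv h \<otimes> k)" using ghk by (simp add: m_assoc)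
    then show "word_dist G S g k \<le> word_dist G S g h + word_dist G S h k"
      using ghk mult_le[of "inv g \<otimes> h" "inv h \<otimes> k"] by (simp add: word_dist_def)
  qed
qed

theorem Metric_space_asymptotic_cone:
  assumes S: "finite_generating_set G S" and \<omega>: "nonprincipal_ultrafilter \<omega>" and d: "\<And>n. d n > 0"
  shows "Metric_space (asymptotic_cone G S \<omega> d) (asymptotic_cone_dist G S \<omega> d)"
proof -
  interpret W: Metric_space "carrier G" "word_dist G S" by (rule Metric_space_word_dist[OF S])
  have "Metric_space (carrier G) (\<lambda>g h. word_dist G S g h / d n)" for n
  proof
    fix g h
    show "0 \<le> word_dist G S g h / d n" using d[of n] by simp
    show "word_dist G S g h / d n = word_dist G S h g / d n" by (simp add: W.commute)
  next
    fix g h assume "g \<in> carrier G" "h \<in> carrier G"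
    then show "word_dist G S g h / d n = 0 \<longleftrightarrow> g = h" using d[of n] by simp
  next
    fix g h k assume "g \<in> carrier G" "h \<in> carrier G" "k \<in> carrier G"
    then show "word_dist G S g k / d n \<le> word_dist G S g h / d n + word_dist G S h k / d n"
      using d[of n] W.triangle[of g h k] by (simp add: add_divide_distrib[symmetric] divide_right_mono)
  qed
  then interpret pointed_metric_sequence \<omega> "\<lambda>n. carrier G" "\<lambda>n g h. word_dist G S g h / d n" "\<lambda>n. \<one>"
    using \<omega> by (intro pointed_metric_sequence.intro) auto
  show ?thesis
    unfolding asymptotic_cone_def asymptotic_cone_dist_def by (rule Metric_space_ultralimit)
qed

end

section \<open>Property FR yields fixed points in real trees on any type\<close>

lemma geodesic_segment_iff:
  assumes "Metric_space T d"
  shows "geodesic_segment T d x y s \<longleftrightarrow>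
    s \<subseteq> T \<and> x \<in> s \<and> y \<in> s \<and> (\<forall>p\<in>s. d x p \<le> d x y) \<and>
    (\<forall>p\<in>s. \<forall>q\<in>s. d p q = \<bar>d x p - d x q\<bar>) \<and> (\<forall>r\<in>{0..d x y}. \<exists>p\<in>s. d x p = r)"
    (is "?L \<longleftrightarrow> ?R")
proof -
  interpret Metric_space T d by fact
  show ?thesis
  proof
    assume ?L
    then obtain \<gamma> :: "real \<Rightarrow> 'a" where g: "\<gamma> ` {0..d x y} \<subseteq> T"
      "\<And>a b. \<lbrakk>a \<in> {0..d x y}; b \<in> {0..d x y}\<rbrakk> \<Longrightarrow> d (\<gamma> a) (\<gamma> b) = \<bar>a - b\<bar>"
      "\<gamma> 0 = x" "\<gamma> (d x y) = y" "s = \<gamma> ` {0..d x y}"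
      unfolding geodesic_segment_def by blast
    have x: "d x (\<gamma> a) = a" if "a \<in> {0..d x y}" for a
      using g(2)[of 0 a] that g(3) by simp
    have "x \<in> s" unfolding g(5) using g(3) by (intro image_eqI[of _ _ 0]) auto
    moreover have "y \<in> s" unfolding g(5) using g(4) by (intro image_eqI[of _ _ "d x y"]) auto
    moreover have "\<forall>r\<in>{0..d x y}. \<exists>p\<in>s. d x p = r" unfolding g(5) using x by blast
    ultimately show ?R using g(1,2) x unfolding g(5) by auto
  next
    assume R: ?R
    then have "\<forall>r\<in>{0..d x y}. \<exists>p. p \<in> s \<and> d x p = r" by blast
    from bchoice[OF this]
    obtain \<gamma> where g: "\<And>r. r \<in> {0..d x y} \<Longrightarrow> \<gamma> r \<in> s \<and> d x (\<gamma> r) = r" by blast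
    have R': "s \<subseteq> T" "x \<in> s" "y \<in> s" "\<And>p. p \<in> s \<Longrightarrow> d x p \<le> d x y"
      "\<And>p q. \<lbrakk>p \<in> s; q \<in> s\<rbrakk> \<Longrightarrow> d p q = \<bar>d x p - d x q\<bar>"
      using R by blast+
    have inj: "p = q" if "p \<in> s" "q \<in> s" "d x p = d x q" for p q
    proof -
      have "d p q = 0" using R'(5)[OF that(1,2)] that(3) by linarith
      then show ?thesis using R'(1) that zero[of p q] by blast
    qed
    have dom: "d x p \<in> {0..d x y}" if "p \<in> s" for p using R'(4)[OF that] by simp
    have gp: "\<gamma> (d x p) = p" if "p \<in> s" for p
      using g[OF dom[OF that]] that by (intro inj) blast+
    show ?L
      unfolding geodesic_segment_def
    proof (intro exI[of _ \<gamma>] conjI)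
      show "\<gamma> ` {0..d x y} \<subseteq> T" using g R'(1) by blast
      show "\<forall>a\<in>{0..d x y}. \<forall>b\<in>{0..d x y}. d (\<gamma> a) (\<gamma> b) = \<bar>a - b\<bar>"
      proof (intro ballI)
        fix a b assume "a \<in> {0..d x y}" "b \<in> {0..d x y}"
        then have ab: "\<gamma> a \<in> s" "d x (\<gamma> a) = a" "\<gamma> b \<in> s" "d x (\<gamma> b) = b" using g by blast+
        show "d (\<gamma> a) (\<gamma> b) = \<bar>a - b\<bar>" using R'(5)[OF ab(1,3)] unfolding ab(2,4) .
      qed
      have "d x x = 0" using R'(1,2) zero[of x x] by blast
      then show "\<gamma> 0 = x" using gp[OF R'(2)] by simp
      show "\<gamma> (d x y) = y" by (rule gp[OF R'(3)])
      show "s = \<gamma> ` {0..d x y}"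
      proof
        show "s \<subseteq> \<gamma> ` {0..d x y}"
        proof
          fix p assume "p \<in> s"
          then show "p \<in> \<gamma> ` {0..d x y}" by (intro image_eqI[of _ _ "d x p"] dom) (simp_all add: gp)
        qed
      qed (use g in blast)
    qed
  qed
qed

context Metric_space
begin

lemma geodesic_segment_commute:
  assumes "geodesic_segment M d x y s" shows "geodesic_segment M d y x s"
proof -
  note iff = geodesic_segment_iff[OF Metric_space_axioms]
  have s: "s \<subseteq> M" "x \<in> s" "y \<in> s" "\<And>p. p \<in> s \<Longrightarrow> d x p \<le> d x y"
    "\<And>p q. \<lbrakk>p \<in> s; q \<in> s\<rbrakk> \<Longrightarrow> d p q = \<bar>d x p - d x q\<bar>"
    "\<And>r. r \<in> {0..d x y} \<Longrightarrow> \<exists>p\<in>s. d x p = r"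
    using assms unfolding iff by blast+
  have y: "d y p = d x y - d x p" if "p \<in> s" for p
    using s(5)[OF s(3) that] s(4)[OF that] by simp
  have "\<exists>p\<in>s. d y p = r" if r: "r \<in> {0..d x y}" for r
  proof -
    obtain p where "p \<in> s" "d x p = d x y - r" using s(6)[of "d x y - r"] r by auto
    then show ?thesis using y by (intro bexI[of _ p]) auto
  qed
  moreover have "d p q = \<bar>d y p - d y q\<bar>" if "p \<in> s" "q \<in> s" for p q
    using s(5)[OF that] y[OF that(1)] y[OF that(2)] by linarith
  moreover have "d y p \<le> d y x" if "p \<in> s" for p using y[OF that] commute[of x y] by simp
  ultimately show ?thesis
    unfolding iff commute[of y x] using s(1-3) by blast
qed

lemma geodesic_segment_end:
  assumes "geodesic_segment M d x y s" "p \<in> s"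
  shows "geodesic_segment M d p y {q \<in> s. d x p \<le> d x q}"
proof -
  note iff = geodesic_segment_iff[OF Metric_space_axioms]
  have s: "s \<subseteq> M" "x \<in> s" "y \<in> s" "\<And>p. p \<in> s \<Longrightarrow> d x p \<le> d x y"
    "\<And>p q. \<lbrakk>p \<in> s; q \<in> s\<rbrakk> \<Longrightarrow> d p q = \<bar>d x p - d x q\<bar>"
    "\<And>r. r \<in> {0..d x y} \<Longrightarrow> \<exists>p\<in>s. d x p = r"
    using assms unfolding iff by blast+
  have p: "d p q = d x q - d x p" if "q \<in> s" "d x p \<le> d x q" for q
    using s(5)[OF assms(2) that(1)] that(2) by simp
  have py: "d p y = d x y - d x p" using p s(3,4) assms(2) by blast
  have "\<exists>q\<in>{q \<in> s. d x p \<le> d x q}. d p q = r" if r: "r \<in> {0..d p y}" for r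
  proof -
    have "r + d x p \<in> {0..d x y}" using r py nonneg[of x p] by (auto simp del: nonneg)
    then obtain q where "q \<in> s" "d x q = r + d x p" using s(6) by blast
    then show ?thesis using p r by (intro bexI[of _ q]) auto
  qed
  moreover have "d q q' = \<bar>d p q - d p q'\<bar>"
    if "q \<in> s" "d x p \<le> d x q" "q' \<in> s" "d x p \<le> d x q'" for q q'
    using s(5)[OF that(1,3)] p[OF that(1,2)] p[OF that(3,4)] by simp
  moreover have "d p q \<le> d p y" if "q \<in> s" "d x p \<le> d x q" for q
    using p[OF that] py s(4)[OF that(1)] by simp
  ultimately show ?thesis
    unfolding iff using s(1,3,4) assms(2) by blast
qed

end

lemma geodesic_segment_subset: "geodesic_segment T d x y s \<Longrightarrow> s \<subseteq> T"
  unfolding geodesic_segment_def by (elim exE conjE) simp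

lemma geodesic_segment_isometry:
  assumes "geodesic_segment T d x y s" "x \<in> T" "y \<in> T" "f ` T \<subseteq> T'"
    "\<And>u v. \<lbrakk>u \<in> T; v \<in> T\<rbrakk> \<Longrightarrow> d' (f u) (f v) = d u v"
  shows "geodesic_segment T' d' (f x) (f y) (f ` s)"
proof -
  obtain \<gamma> :: "real \<Rightarrow> 'a" where g: "\<gamma> ` {0..d x y} \<subseteq> T"
    "\<forall>a\<in>{0..d x y}. \<forall>b\<in>{0..d x y}. d (\<gamma> a) (\<gamma> b) = \<bar>a - b\<bar>"
    "\<gamma> 0 = x" "\<gamma> (d x y) = y" "s = \<gamma> ` {0..d x y}"
    using assms(1) unfolding geodesic_segment_def by blast
  show ?thesis
    unfolding geodesic_segment_def
  proof (intro exI[of _ "f \<circ> \<gamma>"] conjI)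
    show "f ` s = (f \<circ> \<gamma>) ` {0..d' (f x) (f y)}" using g assms by (simp add: image_comp)
  qed (use g assms in \<open>auto simp: image_subset_iff\<close>)
qed

lemma real_tree_side:
  assumes T: "real_tree T d" and s: "geodesic_segment T d x y s" and t: "geodesic_segment T d x z t"
    and u: "geodesic_segment T d y z u"
  shows "u \<subseteq> s \<union> t"
proof -
  interpret Metric_space T d using T by (simp add: real_tree_def)
  note iff = geodesic_segment_iff[OF Metric_space_axioms]
  have s': "s \<subseteq> T" "x \<in> s" "y \<in> s" "\<And>p. p \<in> s \<Longrightarrow> d x p \<le> d x y"
    "\<And>p q. \<lbrakk>p \<in> s; q \<in> s\<rbrakk> \<Longrightarrow> d p q = \<bar>d x p - d x q\<bar>"
    "\<And>r. r \<in> {0..d x y} \<Longrightarrow> \<exists>p\<in>s. d x p = r"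
    using s unfolding iff by blast+
  have t': "t \<subseteq> T" "x \<in> t" "z \<in> t" "\<And>p. p \<in> t \<Longrightarrow> d x p \<le> d x z"
    "\<And>p q. \<lbrakk>p \<in> t; q \<in> t\<rbrakk> \<Longrightarrow> d p q = \<bar>d x p - d x q\<bar>"
    "\<And>r. r \<in> {0..d x z} \<Longrightarrow> \<exists>p\<in>t. d x p = r"
    using t unfolding iff by blast+
  define A where "A = d x ` (s \<inter> t)"
  define a where "a = Sup A"
  have A0: "A \<noteq> {}" using s'(2) t'(2) by (auto simp: A_def)
  have A_le: "r \<le> d x y" "r \<le> d x z" if "r \<in> A" for r
    using that s'(4) t'(4) by (auto simp: A_def)
  then have bdd: "bdd_above A" by (intro bdd_aboveI) blast
  have le: "r \<le> a" if "r \<in> A" for r unfolding a_def using that bdd by (rule cSup_upper)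
  have "a \<ge> 0" using order_trans[OF nonneg le[of "d x x"]] s'(2) t'(2) by (auto simp: A_def)
  moreover have "a \<le> d x y" "a \<le> d x z"
    unfolding a_def using A0 A_le by (auto intro!: cSup_least)
  ultimately obtain p q where p: "p \<in> s" "d x p = a" and q: "q \<in> t" "d x q = a"
    using s'(6)[of a] t'(6)[of a] by fastforce
  have "d p q \<le> e" if e: "e > 0" for e
  proof -
    obtain r where "r \<in> A" "r > a - e / 2"
      using less_cSup_iff[OF A0 bdd, of "a - e / 2"] e unfolding a_def by auto
    then obtain v where v: "v \<in> s" "v \<in> t" "d x v > a - e / 2" "d x v \<le> a"
      using le by (auto simp: A_def)
    have "d p q \<le> d p v + d v q"
      using subsetD[OF s'(1)] subsetD[OF t'(1)] p(1) q(1) v(1) by (intro triangle) blast+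
    then show ?thesis using s'(5)[OF p(1) v(1)] t'(5)[OF v(2) q(1)] v(3,4) p(2) q(2) by linarith
  qed
  then have "d p q \<le> 0" by (rule field_le_epsilon[of _ 0, simplified])
  then have "d p q = 0" using nonneg[of p q] by linarith
  then have "p = q" using zero[of p q] subsetD[OF s'(1) p(1)] subsetD[OF t'(1) q(1)] by blast
  let ?s = "{v \<in> s. d x p \<le> d x v}" and ?t = "{v \<in> t. d x p \<le> d x v}"
  have only: "v = p" if v: "v \<in> s" "v \<in> t" "a \<le> d x v" for v
  proof -
    have "d x v = a" using le[of "d x v"] v by (auto simp: A_def)
    then have "d v p = 0" using s'(5)[OF v(1) p(1)] p(2) by simp
    then show ?thesis using zero[of v p] subsetD[OF s'(1)] v(1) p(1) by blast
  qed
  have "p \<in> t" unfolding \<open>p = q\<close> by (rule q(1))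
  then have i: "?s \<inter> ?t = {p}" using only[folded p(2)] p(1) by blast
  have sp: "geodesic_segment T d y p ?s"
    by (rule geodesic_segment_commute[OF geodesic_segment_end[OF s p(1)]])
  have tp: "geodesic_segment T d p z ?t"
    using geodesic_segment_end[OF t q(1)] unfolding \<open>p = q\<close> .
  have mem: "p \<in> T" "y \<in> T" "z \<in> T" using p(1) s'(1,3) t'(1,3) by blast+
  have g: "geodesic_segment T d y z (s \<union> t)"
    if "x \<in> T" "y \<in> T" "z \<in> T" "geodesic_segment T d y x s" "geodesic_segment T d x z t" "s \<inter> t = {x}"
    for x y z s t using T that by (simp add: real_tree_def)
  have st: "geodesic_segment T d y z (?s \<union> ?t)" by (rule g[OF mem sp tp i])
  have "\<exists>!v. geodesic_segment T d y z v" using T mem(2,3) by (simp add: real_tree_def)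
  then obtain w where w: "\<And>v. geodesic_segment T d y z v \<Longrightarrow> v = w" by (elim ex1E) blast
  have "u = ?s \<union> ?t" using w[OF u] w[OF st] by simp
  then show ?thesis by blast
qed

lemma real_tree_subtree:
  assumes T: "real_tree T d" and U: "U \<subseteq> T" "U \<noteq> {}"
    and convex: "\<And>x y s. \<lbrakk>x \<in> U; y \<in> U; geodesic_segment T d x y s\<rbrakk> \<Longrightarrow> s \<subseteq> U"
  shows "real_tree U d"
proof -
  have MT: "Metric_space T d" using T by (simp add: real_tree_def)
  then have MU: "Metric_space U d" using U(1) by (rule Metric_space.subspace)
  have seg: "geodesic_segment U d x y s \<longleftrightarrow> geodesic_segment T d x y s"
    if "x \<in> U" "y \<in> U" for x y s
  proof
    assume "geodesic_segment U d x y s"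
    from geodesic_segment_isometry[OF this that, of "\<lambda>u. u" T d] U(1)
    show "geodesic_segment T d x y s" by (simp only: image_ident)
  next
    assume s: "geodesic_segment T d x y s"
    then have sU: "s \<subseteq> U" by (rule convex[OF that])
    from s obtain \<gamma> :: "real \<Rightarrow> 'a" where "\<forall>a\<in>{0..d x y}. \<forall>b\<in>{0..d x y}. d (\<gamma> a) (\<gamma> b) = \<bar>a - b\<bar>"
      "\<gamma> 0 = x" "\<gamma> (d x y) = y" "s = \<gamma> ` {0..d x y}"
      unfolding geodesic_segment_def by blast
    then show "geodesic_segment U d x y s"
      unfolding geodesic_segment_def using sU by (intro exI[of _ \<gamma>] conjI) simp_all
  qed
  have u: "\<exists>!s. geodesic_segment T d x y s" if "x \<in> T" "y \<in> T" for x y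
    using T that by (simp add: real_tree_def)
  have g: "geodesic_segment T d y z (s \<union> t)"
    if "x \<in> T" "y \<in> T" "z \<in> T" "geodesic_segment T d y x s" "geodesic_segment T d x z t" "s \<inter> t = {x}"
    for x y z s t using T that by (simp add: real_tree_def)
  show ?thesis
    unfolding real_tree_def
  proof (intro conjI ballI allI impI)
    fix x y assume xy: "x \<in> U" "y \<in> U"
    show "\<exists>!s. geodesic_segment U d x y s"
      unfolding seg[OF xy] by (rule u[OF subsetD[OF U(1) xy(1)] subsetD[OF U(1) xy(2)]])
  next
    fix x y z s t
    assume xyz: "x \<in> U" "y \<in> U" "z \<in> U"
      and st: "geodesic_segment U d y x s \<and> geodesic_segment U d x z t \<and> s \<inter> t = {x}"
    have "geodesic_segment T d y z (s \<union> t)"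
      by (rule g[of x]) (use xyz st U(1) seg[OF xyz(2,1)] seg[OF xyz(1,3)] in blast)+
    then show "geodesic_segment U d y z (s \<union> t)" unfolding seg[OF xyz(2,3)] .
  qed (use MU U(2) in blast)+
qed

lemma real_tree_image:
  assumes T: "real_tree T d" and f: "inj_on f T"
  shows "real_tree (f ` T) (\<lambda>u v. d (inv_into T f u) (inv_into T f v))" (is "real_tree ?U ?d")
proof -
  let ?g = "inv_into T f"
  have MT: "Metric_space T d" using T by (simp add: real_tree_def)
  then interpret Metric_space T d .
  have gf: "?g (f x) = x" if "x \<in> T" for x using f that by simp
  have MU: "Metric_space ?U ?d"
    by unfold_locales (auto simp: gf commute intro: triangle)
  have image: "geodesic_segment ?U ?d (f x) (f y) (f ` s)"
    if "geodesic_segment T d x y s" "x \<in> T" "y \<in> T" for x y s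
    using that by (rule geodesic_segment_isometry) (auto simp: gf)
  have preimage: "geodesic_segment T d x y (?g ` s) \<and> s = f ` (?g ` s)"
    if s: "geodesic_segment ?U ?d (f x) (f y) s" and xy: "x \<in> T" "y \<in> T" for x y s
  proof
    have "geodesic_segment T d (?g (f x)) (?g (f y)) (?g ` s)"
      using s by (rule geodesic_segment_isometry) (auto simp: gf xy)
    then show "geodesic_segment T d x y (?g ` s)" by (simp add: gf xy)
    have "s \<subseteq> ?U" using s by (rule geodesic_segment_subset)
    then show "s = f ` (?g ` s)" by (rule image_inv_into_cancel[OF refl, symmetric])
  qed
  have u: "\<exists>!s. geodesic_segment T d x y s" if "x \<in> T" "y \<in> T" for x y
    using T that by (simp add: real_tree_def)
  have g: "geodesic_segment T d y z (s \<union> t)"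
    if "x \<in> T" "y \<in> T" "z \<in> T" "geodesic_segment T d y x s" "geodesic_segment T d x z t" "s \<inter> t = {x}"
    for x y z s t using T that by (simp add: real_tree_def)
  have unique: "\<exists>!s. geodesic_segment ?U ?d (f x) (f y) s" if xy: "x \<in> T" "y \<in> T" for x y
  proof -
    obtain s where s: "geodesic_segment T d x y s" using u[OF xy] by blast
    show ?thesis
    proof
      show "geodesic_segment ?U ?d (f x) (f y) (f ` s)" by (rule image[OF s xy])
      fix t assume "geodesic_segment ?U ?d (f x) (f y) t"
      from preimage[OF this xy] have t: "geodesic_segment T d x y (?g ` t)" "t = f ` (?g ` t)"
        by (rule conjunct1, rule conjunct2)
      have "?g ` t = s" using u[OF xy] t(1) s by (elim ex1E) blast
      then show "t = f ` s" using t(2) by metis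
    qed
  qed
  have concat: "geodesic_segment ?U ?d (f y) (f z) (s \<union> t)"
    if xyz: "x \<in> T" "y \<in> T" "z \<in> T" and s: "geodesic_segment ?U ?d (f y) (f x) s"
      and t: "geodesic_segment ?U ?d (f x) (f z) t" and st: "s \<inter> t = {f x}" for x y z s t
  proof -
    note s' = conjunct1[OF preimage[OF s xyz(2,1)]] and t' = conjunct1[OF preimage[OF t xyz(1,3)]]
    note fs = conjunct2[OF preimage[OF s xyz(2,1)], symmetric]
      and ft = conjunct2[OF preimage[OF t xyz(1,3)], symmetric]
    have "f x \<in> s" "f x \<in> t" using st by auto
    then have "x \<in> ?g ` s" "x \<in> ?g ` t" using gf[OF xyz(1)] by (metis imageI)+
    moreover have "?g ` s \<subseteq> T" using s' by (rule geodesic_segment_subset)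
    moreover have "v = x" if "v \<in> ?g ` s" "v \<in> ?g ` t" "v \<in> T" for v
    proof -
      have "f v \<in> s" "f v \<in> t"
        using imageI[OF that(1), of f] imageI[OF that(2), of f] unfolding fs ft .
      then have "f v = f x" using st by blast
      then show ?thesis using that(3) xyz(1) by (rule inj_onD[OF f])
    qed
    ultimately have "?g ` s \<inter> ?g ` t = {x}" by blast
    then have "geodesic_segment T d y z (?g ` s \<union> ?g ` t)"
      by (rule g[OF xyz s' t'])
    then have "geodesic_segment ?U ?d (f y) (f z) (f ` (?g ` s) \<union> f ` (?g ` t))"
      unfolding image_Un[symmetric] using xyz(2,3) by (rule image)
    then show ?thesis unfolding fs ft .
  qed
  have "?U \<noteq> {}" using T by (simp add: real_tree_def)
  show ?thesis
    unfolding real_tree_def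
  proof (intro conjI ballI allI impI)
    fix x y assume "x \<in> ?U" "y \<in> ?U"
    then show "\<exists>!s. geodesic_segment ?U ?d x y s" by (elim imageE) (simp only: unique)
  next
    fix x y z s t assume "x \<in> ?U" "y \<in> ?U" "z \<in> ?U"
      "geodesic_segment ?U ?d y x s \<and> geodesic_segment ?U ?d x z t \<and> s \<inter> t = {x}"
    then show "geodesic_segment ?U ?d y z (s \<union> t)"
      by (elim imageE conjE) (simp only: concat)
  qed (fact MU, fact)
qed

lemma (in group) group_actionI:
  assumes closed: "\<And>g x. \<lbrakk>g \<in> carrier G; x \<in> E\<rbrakk> \<Longrightarrow> \<phi> g x \<in> E"
    and ext: "\<And>g. g \<in> carrier G \<Longrightarrow> \<phi> g \<in> extensional E"
    and one: "\<And>x. x \<in> E \<Longrightarrow> \<phi> \<one> x = x"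
    and mult: "\<And>g h x. \<lbrakk>g \<in> carrier G; h \<in> carrier G; x \<in> E\<rbrakk> \<Longrightarrow> \<phi> (g \<otimes> h) x = \<phi> g (\<phi> h x)"
  shows "group_action G E \<phi>"
proof -
  have inv: "\<phi> (inv g) (\<phi> g x) = x" "\<phi> g (\<phi> (inv g) x) = x" if "g \<in> carrier G" "x \<in> E" for g x
    using that mult[of "inv g" g x] mult[of g "inv g" x] one by auto
  have bij: "\<phi> g \<in> Bij E" if g: "g \<in> carrier G" for g
  proof -
    have "bij_betw (\<phi> g) E E"
      by (rule bij_betw_byWitness[where f' = "\<phi> (inv g)"]) (use g inv closed in auto)
    then show ?thesis using ext[OF g] by (simp add: Bij_def)
  qed
  have "\<phi> \<in> hom G (BijGroup E)"
  proof (rule homI)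
    fix g h assume gh: "g \<in> carrier G" "h \<in> carrier G"
    have "\<phi> (g \<otimes> h) = compose E (\<phi> g) (\<phi> h)"
      using ext[of "g \<otimes> h"] gh mult by (intro extensionalityI[of _ E]) (auto simp: compose_def)
    then show "\<phi> (g \<otimes> h) = \<phi> g \<otimes>\<^bsub>BijGroup E\<^esub> \<phi> h" using gh bij by (simp add: BijGroup_def)
  qed (use bij in \<open>simp add: BijGroup_def\<close>)
  then show ?thesis
    by (simp add: group_action_def group_hom_def group_hom_axioms_def group_BijGroup is_group)
qed

theorem (in group) property_FR_fixed_point:
  fixes T :: "'b set"
  assumes FR: "property_FR G" and T: "real_tree T d" and act: "group_action G T \<phi>"
    and isom: "\<And>g x y. \<lbrakk>g \<in> carrier G; x \<in> T; y \<in> T\<rbrakk> \<Longrightarrow> d (\<phi> g x) (\<phi> g y) = d x y"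
  shows "\<exists>x\<in>T. \<forall>g\<in>carrier G. \<phi> g x = x"
proof -
  interpret act: group_action G T \<phi> by fact
  interpret Metric_space T d using T by (simp add: real_tree_def)
  note iff = geodesic_segment_iff[OF Metric_space_axioms]
  have cl: "\<phi> g x \<in> T" if "g \<in> carrier G" "x \<in> T" for g x
    using act.element_image[OF that] by blast
  have mult: "\<phi> (g \<otimes> h) x = \<phi> g (\<phi> h x)" if "g \<in> carrier G" "h \<in> carrier G" "x \<in> T" for g h x
    using act.composition_rule that by blast
  have one: "\<phi> \<one> x = x" if "x \<in> T" for x
    using act.id_eq_one that by (metis restrict_apply')
  obtain c where c: "c \<in> T" using T by (auto simp: real_tree_def)
  have seg: "\<exists>s. geodesic_segment T d x y s" if "x \<in> T" "y \<in> T" for x y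
  proof -
    have "\<exists>!s. geodesic_segment T d x y s" using T that by (simp add: real_tree_def)
    then show ?thesis by (rule ex1_implies_ex)
  qed
  define S where "S h = (SOME s. geodesic_segment T d c (\<phi> h c) s)" for h
  have S: "geodesic_segment T d c (\<phi> h c) (S h)" if "h \<in> carrier G" for h
    unfolding S_def by (rule someI_ex[OF seg[OF c cl[OF that c]]])
  have ST: "S h \<subseteq> T" "c \<in> S h" "\<phi> h c \<in> S h"
    "\<And>p q. \<lbrakk>p \<in> S h; q \<in> S h\<rbrakk> \<Longrightarrow> d p q = \<bar>d c p - d c q\<bar>" if "h \<in> carrier G" for h
    using S[OF that] unfolding iff by blast+
  define U where "U = (\<Union>h\<in>carrier G. S h)"
  have UT: "U \<subseteq> T" using ST(1) by (auto simp: U_def)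
  have orbU: "\<phi> h c \<in> U" if "h \<in> carrier G" for h using ST(3)[OF that] that by (auto simp: U_def)
  have oU: "c \<in> U" using orbU[of \<one>] one[OF c] by simp
  have rad: "s \<subseteq> U" if x: "x \<in> U" and s: "geodesic_segment T d c x s" for x s
  proof -
    obtain h where h: "h \<in> carrier G" "x \<in> S h" using x by (auto simp: U_def)
    have hx: "geodesic_segment T d x (\<phi> h c) {q \<in> S h. d c x \<le> d c q}"
      by (rule geodesic_segment_end[OF S[OF h(1)] h(2)])
    have "s \<subseteq> S h \<union> {q \<in> S h. d c x \<le> d c q}"
      by (rule real_tree_side[OF T geodesic_segment_commute[OF S[OF h(1)]]
            geodesic_segment_commute[OF hx] s])
    then show ?thesis using h by (auto simp: U_def)
  qed
  have convex: "s \<subseteq> U" if x: "x \<in> U" and y: "y \<in> U" and s: "geodesic_segment T d x y s" for x y s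
  proof -
    obtain a where a: "geodesic_segment T d c x a" using seg[OF c subsetD[OF UT x]] by blast
    obtain b where b: "geodesic_segment T d c y b" using seg[OF c subsetD[OF UT y]] by blast
    show ?thesis using real_tree_side[OF T a b s] rad[OF x a] rad[OF y b] by blast
  qed
  have invU: "\<phi> g x \<in> U" if g: "g \<in> carrier G" and x: "x \<in> U" for g x
  proof -
    obtain h where h: "h \<in> carrier G" "x \<in> S h" using x by (auto simp: U_def)
    have "geodesic_segment T d (\<phi> g c) (\<phi> g (\<phi> h c)) (\<phi> g ` S h)"
      by (rule geodesic_segment_isometry[OF S[OF h(1)] c cl[OF h(1) c]])
        (use cl[OF g] isom[OF g] in blast)+
    moreover have "\<phi> g (\<phi> h c) \<in> U" using orbU[of "g \<otimes> h"] mult[OF g h(1) c] g h(1) by simp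
    ultimately have "\<phi> g ` S h \<subseteq> U" using convex[OF orbU[OF g]] by blast
    then show ?thesis using h(2) by blast
  qed
  have treeU: "real_tree U d"
    using oU by (intro real_tree_subtree[OF T UT _ convex]) blast+
  define H where "H p = (SOME h. h \<in> carrier G \<and> p \<in> S h)" for p
  have H: "H p \<in> carrier G" "p \<in> S (H p)" if "p \<in> U" for p
    using someI_ex[of "\<lambda>h. h \<in> carrier G \<and> p \<in> S h"] that by (auto simp: H_def U_def)
  define f where "f p = (H p, d c p)" for p
  have inj: "inj_on f U"
  proof (rule inj_onI)
    fix p q assume pq: "p \<in> U" "q \<in> U" "f p = f q"
    then have "H p = H q" and eq: "d c p = d c q" by (auto simp: f_def)
    then have "q \<in> S (H p)" using H(2)[OF pq(2)] by simp
    then have "d p q = \<bar>d c p - d c q\<bar>" using ST(4)[OF H(1)[OF pq(1)] H(2)[OF pq(1)]] by blast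
    then have "d p q = 0" using eq by simp
    then show "p = q" using pq UT zero[of p q] by blast
  qed
  let ?V = "f ` U" and ?g = "inv_into U f"
  define \<psi> where "\<psi> h = (\<lambda>v\<in>?V. f (\<phi> h (?g v)))" for h
  have gf: "?g (f u) = u" if "u \<in> U" for u using inj that by simp
  have \<psi>f: "\<psi> h (f u) = f (\<phi> h u)" if "u \<in> U" for h u using that by (simp add: \<psi>_def gf)
  have actV: "group_action G ?V \<psi>"
  proof (rule group_actionI)
    fix g assume "g \<in> carrier G"
    show "\<psi> g \<in> extensional ?V" by (simp add: \<psi>_def)
  next
    fix g v assume g: "g \<in> carrier G" and "v \<in> ?V"
    then obtain u where "u \<in> U" "v = f u" by blast
    then show "\<psi> g v \<in> ?V" using \<psi>f[of u g] invU[OF g, of u] by simp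
  next
    fix v assume "v \<in> ?V"
    then obtain u where "u \<in> U" "v = f u" by blast
    then show "\<psi> \<one> v = v" using \<psi>f[of u \<one>] one[of u] UT by auto
  next
    fix g h v assume g: "g \<in> carrier G" and h: "h \<in> carrier G" and "v \<in> ?V"
    then obtain u where u: "u \<in> U" "v = f u" by blast
    then show "\<psi> (g \<otimes> h) v = \<psi> g (\<psi> h v)"
      using \<psi>f[OF u(1)] \<psi>f[OF invU[OF h u(1)]] mult[OF g h subsetD[OF UT u(1)]] by simp
  qed
  have isomV: "\<forall>g\<in>carrier G. \<forall>x\<in>?V. \<forall>y\<in>?V.
      d (?g (\<psi> g x)) (?g (\<psi> g y)) = d (?g x) (?g y)"
  proof (intro ballI)
    fix g x y assume g: "g \<in> carrier G" and "x \<in> ?V" "y \<in> ?V"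
    then obtain u v where u: "u \<in> U" "x = f u" and v: "v \<in> U" "y = f v" by blast
    then show "d (?g (\<psi> g x)) (?g (\<psi> g y)) = d (?g x) (?g y)"
      using invU[OF g u(1)] invU[OF g v(1)] isom[OF g subsetD[OF UT u(1)] subsetD[OF UT v(1)]]
      by (simp add: \<psi>f gf)
  qed
  have "\<exists>v\<in>?V. \<forall>g\<in>carrier G. \<psi> g v = v"
    by (rule FR[unfolded property_FR_def, rule_format,
          of ?V "\<lambda>u v. d (?g u) (?g v)" \<psi>])
      (intro conjI real_tree_image[OF treeU inj] actV isomV)
  then obtain u where u: "u \<in> U" "\<And>g. g \<in> carrier G \<Longrightarrow> \<psi> g (f u) = f u" by blast
  have "\<phi> g u = u" if "g \<in> carrier G" for g
    using u(2)[OF that] \<psi>f[OF u(1)] invU[OF that u(1)] u(1) by (intro inj_onD[OF inj]) auto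
  then show ?thesis using u(1) UT by blast
qed

end

theory Submission
  imports Defs
begin

text \<open>
  The idea is the rescaling argument of Bestvina and Paulin. Fix a finite generating set \<open>S\<close> and
  sequences for which the asymptotic cone is a real tree. The energy of an outer automorphism is the
  least \<open>n\<close> such that some representative maps \<open>S\<close> into the ball of radius \<open>n\<close>. Only finitely many
  classes have energy at most \<open>n\<close> (\<open>finite_energy_le\<close>), because an automorphism is determined by its
  values on \<open>S\<close>.

  The cone is a tree along one sequence of scales \<open>d n\<close> only, so it is not enough to have outer
  automorphisms of large energy: their energies must be comparable to \<open>d n\<close>. This is where finite
  generation enters. Multiplication by a generator multiplies the energy by at most a constant, so on
  its way to infinity the energy cannot jump over an interval \<open>(r, C * r]\<close>
  (\<open>energies_without_large_gaps\<close>). Hence an infinite finitely generated subgroup of \<open>Out G\<close> contains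
  for each \<open>n\<close> a class with energy in \<open>(d n, C * d n]\<close>; let \<open>\<psi> n\<close> be a representative
  that attains its energy.

  Let \<open>G\<close> act on the cone by \<open>g \<cdot> [x\<^sub>n] = [\<psi> n g x\<^sub>n]\<close>. The upper bound on the energy makes this well
  defined and left multiplications are isometries (\<open>cone_action\<close>). A fixed point \<open>[x\<^sub>n]\<close>, which
  property FR provides, means that \<open>inv x\<^sub>n \<otimes> \<psi> n s \<otimes> x\<^sub>n\<close> has length \<open>o(d n)\<close> along the ultrafilter
  for all \<open>s \<in> S\<close>. But conjugation does not change the outer class of \<open>\<psi> n\<close>, so its energy is at
  most \<open>d n\<close> for some \<open>n\<close>, a contradiction.
\<close>

section \<open>Word lengths and homomorphisms\<close>

context group
begin

lemma word_dist_one: "g \<in> carrier G \<Longrightarrow> word_dist G S \<one> g = word_length G S g"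
  by (simp add: word_dist_def)

lemma word_dist_left_mult:
  assumes "g \<in> carrier G" "x \<in> carrier G" "y \<in> carrier G"
  shows "word_dist G S (g \<otimes> x) (g \<otimes> y) = word_dist G S x y"
proof -
  have "inv (g \<otimes> x) \<otimes> (g \<otimes> y) = inv x \<otimes> (inv g \<otimes> (g \<otimes> y))"
    using assms by (simp add: inv_mult_group m_assoc)
  also have "inv g \<otimes> (g \<otimes> y) = y"
    using assms by (simp add: m_assoc[symmetric])
  finally show ?thesis using assms by (simp add: word_dist_def)
qed

lemma word_length_inv:
  assumes S: "finite_generating_set G S" and g: "g \<in> carrier G"
  shows "word_length G S (inv g) = word_length G S g"
proof -
  interpret W: Metric_space "carrier G" "word_dist G S" by (rule Metric_space_word_dist[OF S])
  have "real (word_length G S (inv g)) = word_dist G S g \<one>" using g by (simp add: word_dist_def)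
  also have "\<dots> = word_length G S g" using g by (simp add: W.commute[of g] word_dist_one)
  finally show ?thesis by simp
qed

lemma word_length_mult_le:
  assumes S: "finite_generating_set G S" and g: "g \<in> carrier G" and h: "h \<in> carrier G"
  shows "word_length G S (g \<otimes> h) \<le> word_length G S g + word_length G S h"
proof -
  interpret W: Metric_space "carrier G" "word_dist G S" by (rule Metric_space_word_dist[OF S])
  have "word_dist G S \<one> (g \<otimes> h) \<le> word_dist G S \<one> g + word_dist G S g (g \<otimes> h)"
    using g h by (intro W.triangle) auto
  also have "word_dist G S g (g \<otimes> h) = word_dist G S \<one> h"
    using word_dist_left_mult[of g \<one> h] g h by simp
  finally show ?thesis using g h by (simp add: word_dist_one)
qed

lemma word_length_hom_le:
  assumes S: "finite_generating_set G S" and f: "f \<in> hom G G"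
    and M: "\<And>s. s \<in> S \<Longrightarrow> word_length G S (f s) \<le> M" and g: "g \<in> carrier G"
  shows "word_length G S (f g) \<le> M * word_length G S g"
proof -
  interpret F: group_hom G G f using f by unfold_locales
  have SG: "S \<subseteq> carrier G" using S by (simp add: finite_generating_set_def)
  have bound: "word_length G S (f (foldr (\<lambda>a b. a \<otimes> b) ws \<one>)) \<le> M * length ws"
    if "set ws \<subseteq> S \<union> (\<lambda>s. inv s) ` S" for ws
    using that
  proof (induction ws)
    case Nil
    then show ?case using word_length_eqI[of "[]" 0 S G \<one>] by simp
  next
    case (Cons w ws)
    have w: "w \<in> carrier G" "word_length G S (f w) \<le> M"
      using Cons.prems SG M word_length_inv[OF S] by auto
    have c: "foldr (\<lambda>a b. a \<otimes> b) ws \<one> \<in> carrier G"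
      using Cons.prems by (intro word_prod_closed[OF SG]) simp
    have "word_length G S (f (foldr (\<lambda>a b. a \<otimes> b) (w # ws) \<one>))
        \<le> word_length G S (f w) + word_length G S (f (foldr (\<lambda>a b. a \<otimes> b) ws \<one>))"
      using word_length_mult_le[OF S, of "f w" "f (foldr (\<lambda>a b. a \<otimes> b) ws \<one>)"] w c by simp
    then show ?case using Cons w(2) by simp
  qed
  obtain ws where "length ws = word_length G S g" "set ws \<subseteq> S \<union> (\<lambda>s. inv s) ` S"
    "foldr (\<lambda>a b. a \<otimes> b) ws \<one> = g" using word_length_word[OF S g] .
  then show ?thesis using bound[of ws] by simp
qed

lemma finite_word_ball:
  assumes S: "finite_generating_set G S"
  shows "finite {g \<in> carrier G. word_length G S g \<le> n}"
proof (rule finite_subset)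
  let ?A = "S \<union> (\<lambda>s. inv s) ` S"
  show "finite ((\<lambda>ws. foldr (\<lambda>a b. a \<otimes> b) ws \<one>) ` {ws. set ws \<subseteq> ?A \<and> length ws \<le> n})"
    using S by (intro finite_imageI finite_lists_length_le) (simp add: finite_generating_set_def)
  show "{g \<in> carrier G. word_length G S g \<le> n}
      \<subseteq> (\<lambda>ws. foldr (\<lambda>a b. a \<otimes> b) ws \<one>) ` {ws. set ws \<subseteq> ?A \<and> length ws \<le> n}"
  proof
    fix g assume g: "g \<in> {g \<in> carrier G. word_length G S g \<le> n}"
    then obtain ws where "length ws = word_length G S g" "set ws \<subseteq> ?A"
      "foldr (\<lambda>a b. a \<otimes> b) ws \<one> = g" using word_length_word[OF S] by blast
    with g show "g \<in> (\<lambda>ws. foldr (\<lambda>a b. a \<otimes> b) ws \<one>) ` {ws. set ws \<subseteq> ?A \<and> length ws \<le> n}"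
      by force
  qed
qed

lemma hom_eq_on_generate:
  assumes f: "f \<in> hom G G" and h: "h \<in> hom G G" and S: "S \<subseteq> carrier G"
    and eq: "\<And>s. s \<in> S \<Longrightarrow> f s = h s" and g: "g \<in> generate G S"
  shows "f g = h g"
proof -
  interpret F: group_hom G G f using f by unfold_locales
  interpret H: group_hom G G h using h by unfold_locales
  from g show ?thesis
  proof induction
    case (inv s)
    then show ?case using S eq by (simp add: subsetD)
  next
    case (eng a b)
    then show ?case using generate_in_carrier[OF S] by simp
  qed (simp_all add: eq)
qed

text \<open>
  An automorphism is determined by its values on \<open>S\<close>, and these lie in a finite ball.
\<close>

lemma finite_auto_bounded:
  assumes S: "finite_generating_set G S"
  shows "finite {f \<in> auto G. \<forall>s\<in>S. word_length G S (f s) \<le> n}" (is "finite ?F")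
proof (rule finite_imageD)
  have SG: "S \<subseteq> carrier G" "generate G S = carrier G" and fin: "finite S"
    using S by (auto simp: finite_generating_set_def)
  have cl: "f s \<in> carrier G" if "f \<in> auto G" "s \<in> S" for f s
    using that SG(1) by (auto simp: auto_def hom_def)
  show "finite ((\<lambda>f. restrict f S) ` ?F)"
  proof (rule finite_subset)
    show "(\<lambda>f. restrict f S) ` ?F \<subseteq> (\<Pi>\<^sub>E s\<in>S. {g \<in> carrier G. word_length G S g \<le> n})"
      using cl by auto
    show "finite (\<Pi>\<^sub>E s\<in>S. {g \<in> carrier G. word_length G S g \<le> n})"
      using fin finite_word_ball[OF S] by (intro finite_PiE) auto
  qed
  show "inj_on (\<lambda>f. restrict f S) ?F"
  proof (rule inj_onI)
    fix f h assume f: "f \<in> ?F" and h: "h \<in> ?F" and eq: "restrict f S = restrict h S"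
    have "f s = h s" if "s \<in> S" for s using that fun_cong[OF eq, of s] by simp
    then have "f g = h g" if "g \<in> carrier G" for g
      using f h SG that hom_eq_on_generate[of f h S g] by (auto simp: auto_def)
    then show "f = h"
      using f h by (intro extensionalityI[of _ "carrier G"]) (auto simp: auto_def Bij_def)
  qed
qed

section \<open>The energy of an outer automorphism\<close>

lemma carrier_Out_iff:
  "\<kappa> \<in> carrier (Out G) \<longleftrightarrow>
    (\<exists>f\<in>auto G. \<kappa> = inner_automorphisms G #>\<^bsub>AutoGroup G\<^esub> f)"
  by (auto simp: Out_def FactGroup_def RCOSETS_def AutoGroup_simps)

lemma Out_class_nonempty: "\<kappa> \<in> carrier (Out G) \<Longrightarrow> \<kappa> \<noteq> {}"
proof -
  assume "\<kappa> \<in> carrier (Out G)"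
  then obtain f where f: "f \<in> auto G" "\<kappa> = inner_automorphisms G #>\<^bsub>AutoGroup G\<^esub> f"
    unfolding carrier_Out_iff by blast
  interpret N: normal "inner_automorphisms G" "AutoGroup G" by (rule inner_automorphisms_normal)
  have "f \<in> \<kappa>" unfolding f(2)
    by (rule N.rcos_self) (use f N.subgroup_axioms in \<open>simp_all add: AutoGroup_simps\<close>)
  then show ?thesis by blast
qed

lemma Out_class_in_auto:
  assumes "\<kappa> \<in> carrier (Out G)" "f \<in> \<kappa>"
  shows "f \<in> auto G" and "\<kappa> = inner_automorphisms G #>\<^bsub>AutoGroup G\<^esub> f"
proof -
  interpret N: normal "inner_automorphisms G" "AutoGroup G" by (rule inner_automorphisms_normal)
  obtain h where h: "h \<in> auto G" "\<kappa> = inner_automorphisms G #>\<^bsub>AutoGroup G\<^esub> h"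
    using assms(1) unfolding carrier_Out_iff by blast
  then have h': "h \<in> carrier (AutoGroup G)" by (simp add: AutoGroup_simps)
  show "f \<in> auto G"
    using N.r_coset_subset_G[OF N.subset h'] assms(2) h(2) by (auto simp: AutoGroup_simps)
  show "\<kappa> = inner_automorphisms G #>\<^bsub>AutoGroup G\<^esub> f"
    using N.repr_independence[OF _ h' N.subgroup_axioms, of f] assms(2) h(2) by simp
qed

lemma Out_class_conjugate:
  assumes \<kappa>: "\<kappa> \<in> carrier (Out G)" and f: "f \<in> \<kappa>" and g: "g \<in> carrier G"
  shows "(\<lambda>x\<in>carrier G. g \<otimes> f x \<otimes> inv g) \<in> \<kappa>"
proof -
  let ?c = "\<lambda>x\<in>carrier G. g \<otimes> x \<otimes> inv g"
  note f' = Out_class_in_auto[OF \<kappa> f]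
  have cl: "f x \<in> carrier G" if "x \<in> carrier G" for x
    using f'(1) that by (auto simp: auto_def hom_def)
  have "?c \<in> inner_automorphisms G" using g by (auto simp: inner_automorphisms_def)
  then have "?c \<otimes>\<^bsub>AutoGroup G\<^esub> f \<in> \<kappa>"
    by (subst f'(2)) (auto simp: r_coset_def)
  also have "?c \<otimes>\<^bsub>AutoGroup G\<^esub> f = (\<lambda>x\<in>carrier G. g \<otimes> f x \<otimes> inv g)"
    using f'(1) cl by (auto simp: AutoGroup_simps inner_automorphism_in_auto[OF g] compose_def fun_eq_iff)
  finally show ?thesis .
qed

lemma Out_class_compose:
  assumes "\<kappa> \<in> carrier (Out G)" "\<kappa>' \<in> carrier (Out G)" "f \<in> \<kappa>" "h \<in> \<kappa>'"
  shows "compose (carrier G) f h \<in> \<kappa> \<otimes>\<^bsub>Out G\<^esub> \<kappa>'"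
proof -
  have "f \<otimes>\<^bsub>AutoGroup G\<^esub> h \<in> \<kappa> \<otimes>\<^bsub>Out G\<^esub> \<kappa>'"
    using assms(3,4) by (auto simp: Out_def FactGroup_def set_mult_def)
  then show ?thesis
    using Out_class_in_auto(1)[OF assms(1,3)] Out_class_in_auto(1)[OF assms(2,4)]
    by (simp add: AutoGroup_simps)
qed

end

definition energy :: "('a, 'm) monoid_scheme \<Rightarrow> 'a set \<Rightarrow> ('a \<Rightarrow> 'a) set \<Rightarrow> nat"
  where "energy G S \<kappa> = (LEAST n. \<exists>f\<in>\<kappa>. \<forall>s\<in>S. word_length G S (f s) \<le> n)"

lemma energy_le: "\<lbrakk>f \<in> \<kappa>; \<And>s. s \<in> S \<Longrightarrow> word_length G S (f s) \<le> n\<rbrakk> \<Longrightarrow> energy G S \<kappa> \<le> n"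
  unfolding energy_def by (rule Least_le) blast

context group
begin

lemma energy_attained:
  assumes S: "finite S" and \<kappa>: "\<kappa> \<in> carrier (Out G)"
  shows "\<exists>f\<in>\<kappa>. \<forall>s\<in>S. word_length G S (f s) \<le> energy G S \<kappa>"
proof -
  obtain f where f: "f \<in> \<kappa>" using Out_class_nonempty[OF \<kappa>] by blast
  have "\<forall>s\<in>S. word_length G S (f s) \<le> (\<Sum>s\<in>S. word_length G S (f s))"
    using S by (intro ballI member_le_sum) auto
  then have "\<exists>n. \<exists>f\<in>\<kappa>. \<forall>s\<in>S. word_length G S (f s) \<le> n" using f by blast
  then show ?thesis unfolding energy_def by (rule LeastI_ex)
qed

lemma finite_energy_le:
  assumes S: "finite_generating_set G S"
  shows "finite {\<kappa> \<in> carrier (Out G). energy G S \<kappa> \<le> n}"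
proof (rule finite_subset)
  let ?F = "{f \<in> auto G. \<forall>s\<in>S. word_length G S (f s) \<le> n}"
  show "finite ((\<lambda>f. inner_automorphisms G #>\<^bsub>AutoGroup G\<^esub> f) ` ?F)"
    by (intro finite_imageI finite_auto_bounded[OF S])
  show "{\<kappa> \<in> carrier (Out G). energy G S \<kappa> \<le> n}
      \<subseteq> (\<lambda>f. inner_automorphisms G #>\<^bsub>AutoGroup G\<^esub> f) ` ?F"
  proof
    fix \<kappa> assume \<kappa>: "\<kappa> \<in> {\<kappa> \<in> carrier (Out G). energy G S \<kappa> \<le> n}"
    have fin: "finite S" using S by (simp add: finite_generating_set_def)
    obtain f where f: "f \<in> \<kappa>" "\<And>s. s \<in> S \<Longrightarrow> word_length G S (f s) \<le> energy G S \<kappa>"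
      using energy_attained[OF fin] \<kappa> by blast
    have "f \<in> ?F" using f(2) \<kappa> Out_class_in_auto(1)[OF _ f(1)] by fastforce
    moreover have "\<kappa> = inner_automorphisms G #>\<^bsub>AutoGroup G\<^esub> f"
      using Out_class_in_auto(2)[OF _ f(1)] \<kappa> by blast
    ultimately show "\<kappa> \<in> (\<lambda>f. inner_automorphisms G #>\<^bsub>AutoGroup G\<^esub> f) ` ?F" by blast
  qed
qed

text \<open>
  The maximal length of \<open>f s\<close> for \<open>s \<in> S\<close> is the Lipschitz constant of \<open>f\<close>, and Lipschitz constants
  are submultiplicative under composition.
\<close>

lemma energy_mult_le:
  assumes S: "finite_generating_set G S"
    and \<kappa>: "\<kappa> \<in> carrier (Out G)" and \<kappa>': "\<kappa>' \<in> carrier (Out G)"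
  shows "energy G S (\<kappa> \<otimes>\<^bsub>Out G\<^esub> \<kappa>') \<le> energy G S \<kappa> * energy G S \<kappa>'"
proof -
  have fin: "finite S" and SG: "S \<subseteq> carrier G" using S by (simp_all add: finite_generating_set_def)
  obtain f where f: "f \<in> \<kappa>" "\<And>s. s \<in> S \<Longrightarrow> word_length G S (f s) \<le> energy G S \<kappa>"
    using energy_attained[OF fin \<kappa>] by blast
  obtain h where h: "h \<in> \<kappa>'" "\<And>s. s \<in> S \<Longrightarrow> word_length G S (h s) \<le> energy G S \<kappa>'"
    using energy_attained[OF fin \<kappa>'] by blast
  have fh: "f \<in> hom G G" "h \<in> hom G G"
    using Out_class_in_auto(1)[OF \<kappa> f(1)] Out_class_in_auto(1)[OF \<kappa>' h(1)] by (auto simp: auto_def)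
  show ?thesis
  proof (rule energy_le[OF Out_class_compose[OF \<kappa> \<kappa>' f(1) h(1)]])
    fix s assume s: "s \<in> S"
    then have sG: "s \<in> carrier G" using SG by blast
    then have "h s \<in> carrier G" using fh(2) by (auto simp: hom_def)
    then have "word_length G S (f (h s)) \<le> energy G S \<kappa> * word_length G S (h s)"
      using f(2) by (intro word_length_hom_le[OF S fh(1)])
    also have "\<dots> \<le> energy G S \<kappa> * energy G S \<kappa>'" using h(2)[OF s] by (rule mult_le_mono2)
    finally show "word_length G S (compose (carrier G) f h s) \<le> energy G S \<kappa> * energy G S \<kappa>'"
      using sG by (simp add: compose_def)
  qed
qed

text \<open>
  A walk in the Cayley graph of \<open>K\<close> that starts at the identity class multiplies the energy by at
  most \<open>C\<close> in each step. If no energy lay in \<open>(r, C * r]\<close>, the walk could never leave the classes of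
  energy at most \<open>r\<close>, and these are finite in number.
\<close>

lemma energies_without_large_gaps:
  fixes c :: real
  assumes S: "finite_generating_set G S" and K: "subgroup K (Out G)"
    and fg: "finitely_generated_group ((Out G)\<lparr>carrier := K\<rparr>)" and inf: "infinite K"
    and c: "c > 0"
  obtains C :: real where
    "\<And>r :: real. c \<le> r \<Longrightarrow> \<exists>\<kappa>\<in>K. r < energy G S \<kappa> \<and> energy G S \<kappa> \<le> C * r"
proof -
  let ?O = "Out G" and ?e = "energy G S"
  interpret O: group ?O by (rule group_Out)
  interpret K: subgroup K ?O by fact
  obtain A where A: "finite A" "A \<subseteq> K" "generate (?O\<lparr>carrier := K\<rparr>) A = K"
    using fg by (auto simp: finitely_generated_group_def finite_generating_set_def)
  have gen: "generate ?O A = K" using O.generate_consistent[OF A(2) K] A(3) by simp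
  let ?B = "A \<union> (\<lambda>a. inv\<^bsub>?O\<^esub> a) ` A"
  (* The summand ?e 1 / c covers the scales r in [c, ?e 1), where the identity class is the witness. *)
  define C where "C = real (\<Sum>b\<in>?B. ?e b) + ?e \<one>\<^bsub>?O\<^esub> / c"
  have C: "?e b \<le> C" if "b \<in> ?B" for b
  proof -
    have "?e b \<le> (\<Sum>b\<in>?B. ?e b)" using that A(1) by (intro member_le_sum) auto
    then have "real (?e b) \<le> real (\<Sum>b\<in>?B. ?e b)" by (simp only: of_nat_le_iff)
    moreover have "0 \<le> ?e \<one>\<^bsub>?O\<^esub> / c" using c by simp
    ultimately show ?thesis unfolding C_def by linarith
  qed
  have C1: "?e \<one>\<^bsub>?O\<^esub> \<le> C * r" if "c \<le> r" for r :: real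
  proof -
    have "?e \<one>\<^bsub>?O\<^esub> = ?e \<one>\<^bsub>?O\<^esub> / c * c" using c by simp
    also have "\<dots> \<le> C * r" using c that unfolding C_def by (intro mult_mono) (simp_all add: sum_nonneg)
    finally show ?thesis .
  qed
  have "\<exists>\<kappa>\<in>K. r < ?e \<kappa> \<and> ?e \<kappa> \<le> C * r" if cr: "c \<le> r" for r :: real
  proof (rule ccontr)
    assume "\<not> ?thesis"
    then have gap: "?e \<kappa> \<le> r" if "\<kappa> \<in> K" "?e \<kappa> \<le> C * r" for \<kappa>
      using that by (meson not_le)
    have r: "?e \<one>\<^bsub>?O\<^esub> \<le> r" using gap[OF K.one_closed C1[OF cr]] .
    have B: "b \<in> K" if "b \<in> ?B" for b using that A(2) by auto
    have step: "?e (\<kappa> \<otimes>\<^bsub>?O\<^esub> b) \<le> r" if \<kappa>: "\<kappa> \<in> K" "?e \<kappa> \<le> r" and b: "b \<in> ?B" for \<kappa> b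
    proof (rule gap)
      show "\<kappa> \<otimes>\<^bsub>?O\<^esub> b \<in> K" using \<kappa>(1) B[OF b] by simp
      have "?e (\<kappa> \<otimes>\<^bsub>?O\<^esub> b) \<le> ?e \<kappa> * ?e b"
        using \<kappa>(1) B[OF b] K.subset by (intro energy_mult_le[OF S]) auto
      then have "real (?e (\<kappa> \<otimes>\<^bsub>?O\<^esub> b)) \<le> real (?e \<kappa>) * real (?e b)"
        unfolding of_nat_mult[symmetric] of_nat_le_iff .
      also have "\<dots> \<le> r * C" using \<kappa>(2) C[OF b] cr c by (intro mult_mono) auto
      finally show "?e (\<kappa> \<otimes>\<^bsub>?O\<^esub> b) \<le> C * r" by (simp add: mult.commute)
    qed
    (* Quantifying over all \<kappa> makes the property closed under products in the induction on h. *)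
    have stay: "\<forall>\<kappa>\<in>K. ?e \<kappa> \<le> r \<longrightarrow> ?e (\<kappa> \<otimes>\<^bsub>?O\<^esub> h) \<le> r" if "h \<in> generate ?O A" for h
      using that
    proof induction
      case one
      then show ?case using K.subset by auto
    next
      case (incl h)
      then show ?case using step by blast
    next
      case (inv h)
      then show ?case using step by blast
    next
      case (eng h1 h2)
      have h: "h1 \<in> K" "h2 \<in> K" using eng.hyps gen by auto
      show ?case
      proof (intro ballI impI)
        fix \<kappa> assume \<kappa>: "\<kappa> \<in> K" "?e \<kappa> \<le> r"
        then have "?e ((\<kappa> \<otimes>\<^bsub>?O\<^esub> h1) \<otimes>\<^bsub>?O\<^esub> h2) \<le> r" using eng.IH h by simp
        then show "?e (\<kappa> \<otimes>\<^bsub>?O\<^esub> (h1 \<otimes>\<^bsub>?O\<^esub> h2)) \<le> r"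
          using \<kappa>(1) h K.subset by (simp add: O.m_assoc subset_iff)
      qed
    qed
    have "?e h \<le> r" if "h \<in> K" for h
      using stay[of h] that r gen K.one_closed K.subset by (metis O.l_one subsetD)
    then have "K \<subseteq> {\<kappa> \<in> carrier ?O. ?e \<kappa> \<le> nat \<lfloor>r\<rfloor>}"
      using K.subset by (auto intro: le_nat_floor)
    then show False using finite_energy_le[OF S] inf finite_subset by blast
  qed
  then show ?thesis by (rule that)
qed

section \<open>Actions on the asymptotic cone by left multiplication\<close>

lemma pointed_metric_sequence_cone:
  fixes d :: "nat \<Rightarrow> real"
  assumes S: "finite_generating_set G S" and \<omega>: "nonprincipal_ultrafilter \<omega>" and d: "\<And>n. d n > 0"
  shows "pointed_metric_sequence \<omega> (\<lambda>n. carrier G) (\<lambda>n g h. word_dist G S g h / d n) (\<lambda>n. \<one>)"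
proof -
  interpret W: Metric_space "carrier G" "word_dist G S" by (rule Metric_space_word_dist[OF S])
  have "Metric_space (carrier G) (\<lambda>g h. word_dist G S g h / d n)" for n
  proof
    fix g h k assume "g \<in> carrier G" "h \<in> carrier G" "k \<in> carrier G"
    then show "word_dist G S g k / d n \<le> word_dist G S g h / d n + word_dist G S h k / d n"
      using d[of n] W.triangle[of g h k] by (simp add: add_divide_distrib[symmetric] divide_right_mono)
  qed (use d[of n] W.commute in \<open>auto simp: less_imp_le\<close>)
  then show ?thesis using \<omega> by (intro pointed_metric_sequence.intro) auto
qed

text \<open>
  The hypothesis on \<open>\<psi>\<close> says that \<open>\<psi> n\<close> is \<open>C * d n\<close>-Lipschitz, so after rescaling by \<open>d n\<close> the
  elements \<open>\<psi> n g\<close> stay at bounded distance from the base point. Points of the cone are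
  equivalence classes of sequences; multiplication by \<open>\<psi> n g\<close> permutes the sequences and respects
  the equivalence in both directions, so the image of a class is again a class.
\<close>

lemma cone_action:
  fixes d :: "nat \<Rightarrow> real"
  assumes S: "finite_generating_set G S" and \<omega>: "nonprincipal_ultrafilter \<omega>" and d: "\<And>n. d n > 0"
    and \<psi>: "\<And>n. \<psi> n \<in> hom G G"
    and C: "\<And>n s. s \<in> S \<Longrightarrow> word_length G S (\<psi> n s) \<le> C * d n"
  defines "\<rho> \<equiv> \<lambda>g. \<lambda>A\<in>asymptotic_cone G S \<omega> d. (\<lambda>x n. \<psi> n g \<otimes> x n) ` A"
  shows "group_action G (asymptotic_cone G S \<omega> d) \<rho>"
    and "\<And>g A B. \<lbrakk>g \<in> carrier G; A \<in> asymptotic_cone G S \<omega> d; B \<in> asymptotic_cone G S \<omega> d\<rbrakk> \<Longrightarrow>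
      asymptotic_cone_dist G S \<omega> d (\<rho> g A) (\<rho> g B) = asymptotic_cone_dist G S \<omega> d A B"
proof -
  let ?X = "\<lambda>n::nat. carrier G" and ?D = "\<lambda>n g h. word_dist G S g h / d n" and ?p = "\<lambda>n::nat. \<one>"
  interpret P: pointed_metric_sequence \<omega> ?X ?D ?p
    by (rule pointed_metric_sequence_cone[OF S \<omega> d])
  let ?Q = "ultralimit_seqs ?X ?D ?p" and ?R = "ultralimit_rel \<omega> ?X ?D ?p"
  let ?L = "asymptotic_cone G S \<omega> d"
  have L: "?L = ultralimit \<omega> ?X ?D ?p" by (simp add: asymptotic_cone_def)
  define m where "m g x n = \<psi> n g \<otimes> x n" for g x n
  have \<rho>: "\<rho> g A = m g ` A" if "A \<in> ?L" for g A using that by (simp add: \<rho>_def m_def[abs_def])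
  have \<psi>c: "\<psi> n g \<in> carrier G" if "g \<in> carrier G" for n g using \<psi>[of n] that by (auto simp: hom_def)
  have Q_iff: "x \<in> ?Q \<longleftrightarrow> (\<forall>n. x n \<in> carrier G) \<and> (\<exists>B. \<forall>n. word_length G S (x n) / d n \<le> B)" for x
    by (simp add: ultralimit_seqs_def word_dist_one cong: conj_cong)
  have mQ: "m g x \<in> ?Q" if g: "g \<in> carrier G" and x: "x \<in> ?Q" for g x
  proof -
    have xc: "x n \<in> carrier G" for n using x by (simp add: Q_iff)
    obtain B where B: "\<And>n. word_length G S (x n) / d n \<le> B" using x by (auto simp: Q_iff)
    have "word_length G S (m g x n) / d n \<le> \<bar>C\<bar> * word_length G S g + B" for n
    proof -
      have "word_length G S (\<psi> n s) \<le> nat \<lfloor>C * d n\<rfloor>" if "s \<in> S" for s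
        using C[OF that] by (rule le_nat_floor)
      then have "word_length G S (\<psi> n g) \<le> nat \<lfloor>C * d n\<rfloor> * word_length G S g"
        by (rule word_length_hom_le[OF S \<psi> _ g])
      then have "real (word_length G S (\<psi> n g)) \<le> real (nat \<lfloor>C * d n\<rfloor>) * word_length G S g"
        unfolding of_nat_mult[symmetric] of_nat_le_iff .
      also have "real (nat \<lfloor>C * d n\<rfloor>) \<le> \<bar>C * d n\<bar>" by linarith
      also have "\<bar>C * d n\<bar> = \<bar>C\<bar> * d n" using d[of n] by (simp add: abs_mult)
      finally have "real (word_length G S (\<psi> n g)) / d n \<le> \<bar>C\<bar> * word_length G S g"
        using d[of n] by (simp add: pos_divide_le_eq mult_ac mult_right_mono)
      moreover have "real (word_length G S (m g x n)) \<le> word_length G S (\<psi> n g) + word_length G S (x n)"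
        unfolding m_def of_nat_add[symmetric] of_nat_le_iff
        by (rule word_length_mult_le[OF S \<psi>c[OF g] xc])
      then have "real (word_length G S (m g x n)) / d n
          \<le> word_length G S (\<psi> n g) / d n + word_length G S (x n) / d n"
        using d[of n] by (simp add: add_divide_distrib[symmetric] divide_right_mono)
      ultimately show ?thesis using B[of n] by linarith
    qed
    then show ?thesis unfolding Q_iff using xc \<psi>c[OF g] by (auto simp: m_def)
  qed
  have mD: "?D n (m g x n) (m g y n) = ?D n (x n) (y n)"
    if "g \<in> carrier G" "x \<in> ?Q" "y \<in> ?Q" for g x y n
    using that by (simp add: m_def word_dist_left_mult \<psi>c Q_iff)
  have mR: "(m g x, m g y) \<in> ?R" if "g \<in> carrier G" "(x, y) \<in> ?R" for g x y
  proof -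
    have xy: "x \<in> ?Q" "y \<in> ?Q" "((\<lambda>n. ?D n (x n) (y n)) \<longlongrightarrow> 0) \<omega>"
      using that(2) by (auto simp: ultralimit_rel_def)
    have "(\<lambda>n. ?D n (m g x n) (m g y n)) = (\<lambda>n. ?D n (x n) (y n))"
      by (rule ext) (rule mD[OF that(1) xy(1,2)])
    then have "((\<lambda>n. ?D n (m g x n) (m g y n)) \<longlongrightarrow> 0) \<omega>" using xy(3) by (simp only:)
    then show ?thesis using mQ[OF that(1)] xy(1,2) by (simp add: ultralimit_rel_def)
  qed
  have mm: "m (g \<otimes> h) x = m g (m h x)"
    if "g \<in> carrier G" "h \<in> carrier G" "x \<in> ?Q" for g h x
    using that by (auto simp: m_def fun_eq_iff hom_mult[OF \<psi>] m_assoc \<psi>c Q_iff)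
  have m1: "m \<one> x = x" if "x \<in> ?Q" for x
    using that by (auto simp: m_def fun_eq_iff hom_one[OF \<psi> is_group is_group] Q_iff)
  have AQ: "A \<subseteq> ?Q" if "A \<in> ?L" for A
    using that P.equiv_R unfolding L ultralimit_def by (rule in_quotient_imp_subset[rotated])
  have mL: "m g ` A \<in> ?L" if g: "g \<in> carrier G" and A: "A \<in> ?L" for g A
  proof -
    obtain x where x: "x \<in> ?Q" "A = ?R `` {x}" using A unfolding L ultralimit_def by (rule quotientE)
    have "m g ` A = ?R `` {m g x}"
    proof
      show "m g ` A \<subseteq> ?R `` {m g x}" unfolding x(2) using mR[OF g] by auto
      show "?R `` {m g x} \<subseteq> m g ` A"
      proof
        fix y assume "y \<in> ?R `` {m g x}"
        then have y: "(m g x, y) \<in> ?R" "y \<in> ?Q" by (auto simp: ultralimit_rel_def)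
        have "m (inv g) (m g x) = x" using mm[of "inv g" g x] m1 g x by simp
        then have "(x, m (inv g) y) \<in> ?R" using mR[OF _ y(1), of "inv g"] g by simp
        moreover have "m g (m (inv g) y) = y" using mm[of g "inv g" y] m1 g y(2) by simp
        ultimately show "y \<in> m g ` A" unfolding x(2) by force
      qed
    qed
    then show ?thesis unfolding L ultralimit_def using mQ[OF g x(1)] by (simp add: quotientI)
  qed
  show "group_action G ?L \<rho>"
  proof (rule group_actionI)
    show "\<rho> g \<in> extensional ?L" for g by (simp add: \<rho>_def)
    show "\<rho> \<one> A = A" if "A \<in> ?L" for A
      using AQ[OF that] m1 by (force simp: \<rho>[OF that])
    show "\<rho> (g \<otimes> h) A = \<rho> g (\<rho> h A)"
      if "g \<in> carrier G" "h \<in> carrier G" "A \<in> ?L" for g h A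
    proof -
      have "m (g \<otimes> h) ` A = m g ` m h ` A"
        unfolding image_image using AQ[OF that(3)] mm[OF that(1,2)] by (intro image_cong) auto
      then show ?thesis using that by (simp add: \<rho> mL)
    qed
  qed (simp add: \<rho> mL)
  fix g A B assume g: "g \<in> carrier G" and AB: "A \<in> ?L" "B \<in> ?L"
  obtain x y where xy: "x \<in> A" "x \<in> ?Q" "y \<in> B" "y \<in> ?Q"
    using P.ultralimit_nonempty AB unfolding L by blast
  have dist: "asymptotic_cone_dist G S \<omega> d A B = Lim \<omega> (\<lambda>n. ?D n (x n) (y n))"
    if "A \<in> ?L" "B \<in> ?L" "x \<in> A" "y \<in> B" for A B x y
    using P.ultralimit_dist_eq[OF that[unfolded L]] by (simp add: asymptotic_cone_dist_def)
  have "asymptotic_cone_dist G S \<omega> d (m g ` A) (m g ` B) = Lim \<omega> (\<lambda>n. ?D n (m g x n) (m g y n))"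
    using mL[OF g] AB xy by (intro dist) auto
  also have "\<dots> = asymptotic_cone_dist G S \<omega> d A B"
    unfolding dist[OF AB xy(1,3)] mD[OF g xy(2,4)] ..
  finally show "asymptotic_cone_dist G S \<omega> d (\<rho> g A) (\<rho> g B) = asymptotic_cone_dist G S \<omega> d A B"
    using AB by (simp add: \<rho>)
qed

end

section \<open>Fixed points in trees with points of any type\<close>

text \<open>
  The statement of \<open>property_FR_fixed_point\<close> ties the type of the points of the tree to the type of
  the record extension of the group. Neither property FR nor the
  notion of an action sees the extension, so it can be replaced by one of the type of the points.
\<close>

lemma property_FR_fixed_point_any_type:
  fixes G :: "('a, 'm) monoid_scheme" and T :: "'c set"
  assumes G: "group G" and FR: "property_FR G" and T: "real_tree T d"
    and act: "group_action G T \<phi>"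
    and isom: "\<And>g x y. \<lbrakk>g \<in> carrier G; x \<in> T; y \<in> T\<rbrakk> \<Longrightarrow> d (\<phi> g x) (\<phi> g y) = d x y"
  shows "\<exists>x\<in>T. \<forall>g\<in>carrier G. \<phi> g x = x"
proof -
  let ?H = "\<lparr>carrier = carrier G, monoid.mult = monoid.mult G, one = one G, \<dots> = undefined :: 'c\<rparr>"
  have group_iff: "group ?H \<longleftrightarrow> group G"
    unfolding group_def group_axioms_def monoid_def Units_def
    by (simp only: partial_object.simps monoid.simps)
  have action_iff: "group_action ?H E \<theta> \<longleftrightarrow> group_action G E \<theta>" for E :: "'e set" and \<theta>
    unfolding group_action_def group_hom_def group_hom_axioms_def group_iff hom_def
    by (simp only: partial_object.simps monoid.simps)
  have H: "carrier ?H = carrier G" by (simp only: partial_object.simps)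
  have "property_FR ?H" using FR unfolding property_FR_def action_iff H .
  moreover have "group ?H" "group_action ?H T \<phi>" using G act unfolding group_iff action_iff .
  ultimately show ?thesis
    using group.property_FR_fixed_point[of ?H T d \<phi>] T isom unfolding H by blast
qed

section \<open>Local finiteness of the outer automorphism group\<close>

theorem theorem1p1:
  fixes G :: "('a, 'm) monoid_scheme"
  assumes "group G"
    and "lacunary_hyperbolic G"
    and "property_FR G"
  shows "locally_finite_group (Out G)"
proof -
  interpret group G by fact
  obtain S \<omega> d where S: "finite_generating_set G S" and \<omega>: "nonprincipal_ultrafilter \<omega>"
    and d: "\<And>n. d n > 0" and lim: "filterlim d at_top sequentially"
    and tree: "real_tree (asymptotic_cone G S \<omega> d) (asymptotic_cone_dist G S \<omega> d)"
    using assms(2) by (auto simp: lacunary_hyperbolic_def)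
  let ?T = "asymptotic_cone G S \<omega> d"
  have fin: "finite S" and SG: "S \<subseteq> carrier G" using S by (simp_all add: finite_generating_set_def)
  interpret P: pointed_metric_sequence \<omega> "\<lambda>n. carrier G" "\<lambda>n g h. word_dist G S g h / d n" "\<lambda>n. \<one>\<^bsub>G\<^esub>"
    by (rule pointed_metric_sequence_cone[OF S \<omega> d])
  show ?thesis
    unfolding locally_finite_group_def
  proof (intro allI impI, rule ccontr)
    fix K assume "subgroup K (Out G) \<and> finitely_generated_group ((Out G)\<lparr>carrier := K\<rparr>)"
      and inf: "infinite K"
    then have K: "subgroup K (Out G)" and fg: "finitely_generated_group ((Out G)\<lparr>carrier := K\<rparr>)"
      by simp_all
    have KO: "K \<subseteq> carrier (Out G)" using K by (rule subgroup.subset)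
    (* A bound on d n from below: the constant in the bound on the energies must serve every n,
       because the points of the cone are given by sequences bounded at every index. *)
    obtain c where c: "c > 0" "\<And>n. c \<le> d n"
    proof -
      obtain N where N: "\<And>n. N \<le> n \<Longrightarrow> 1 \<le> d n"
        using lim by (auto simp: filterlim_at_top eventually_sequentially)
      let ?c = "Min (insert 1 (d ` {..<N}))"
      have "?c > 0" using d by (subst Min_gr_iff) auto
      moreover have "?c \<le> d n" for n
      proof (cases "n < N")
        case False
        then show ?thesis using N[of n] by (intro order_trans[OF Min_le[of _ 1]]) auto
      qed (auto intro: Min_le)
      ultimately show ?thesis by (rule that)
    qed
    obtain B :: real where "\<And>r :: real. c \<le> r \<Longrightarrow> \<exists>\<kappa>\<in>K. r < energy G S \<kappa> \<and> energy G S \<kappa> \<le> B * r"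
      using energies_without_large_gaps[OF S K fg inf c(1)] by blast
    then have "\<exists>\<kappa>\<in>K. d n < energy G S \<kappa> \<and> energy G S \<kappa> \<le> B * d n" for n
      using c(2) by blast
    then obtain \<kappa> where \<kappa>: "\<And>n. \<kappa> n \<in> K" "\<And>n. d n < energy G S (\<kappa> n)"
      "\<And>n. energy G S (\<kappa> n) \<le> B * d n" by metis
    have \<kappa>O: "\<kappa> n \<in> carrier (Out G)" for n using \<kappa>(1) KO by blast
    have "\<forall>n. \<exists>f. f \<in> \<kappa> n \<and> (\<forall>s\<in>S. word_length G S (f s) \<le> energy G S (\<kappa> n))"
      using energy_attained[OF fin \<kappa>O] by blast
    from choice[OF this] obtain \<psi> where \<psi>: "\<And>n. \<psi> n \<in> \<kappa> n"
      "\<And>n s. s \<in> S \<Longrightarrow> word_length G S (\<psi> n s) \<le> energy G S (\<kappa> n)" by blast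
    have hom: "\<psi> n \<in> hom G G" for n
      using Out_class_in_auto(1)[OF \<kappa>O \<psi>(1)] by (simp add: auto_def)
    have bound: "word_length G S (\<psi> n s) \<le> B * d n" if "s \<in> S" for n s
      using \<psi>(2)[OF that, of n] \<kappa>(3)[of n] by linarith
    define \<rho> where "\<rho> g = (\<lambda>A\<in>?T. (\<lambda>x n. \<psi> n g \<otimes>\<^bsub>G\<^esub> x n) ` A)" for g
    have "group_action G ?T \<rho>"
      unfolding \<rho>_def[abs_def] by (rule cone_action(1)[OF S \<omega> d hom]) (rule bound)
    then have "\<exists>A\<in>?T. \<forall>g\<in>carrier G. \<rho> g A = A"
    proof (rule property_FR_fixed_point_any_type[OF assms(1,3) tree])
      show "asymptotic_cone_dist G S \<omega> d (\<rho> g A) (\<rho> g B) = asymptotic_cone_dist G S \<omega> d A B"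
        if "g \<in> carrier G" "A \<in> ?T" "B \<in> ?T" for g A B
        unfolding \<rho>_def by (rule cone_action(2)[OF S \<omega> d hom _ that]) (rule bound)
    qed
    then obtain A where A: "A \<in> ?T" "\<And>g. g \<in> carrier G \<Longrightarrow> \<rho> g A = A" by blast
    obtain x where x: "x \<in> A" "x \<in> ultralimit_seqs (\<lambda>n. carrier G) (\<lambda>n g h. word_dist G S g h / d n) (\<lambda>n. \<one>\<^bsub>G\<^esub>)"
      using P.ultralimit_nonempty A(1) unfolding asymptotic_cone_def by blast
    have xc: "x n \<in> carrier G" for n using P.in_X[OF x(2)] .
    have "eventually (\<lambda>n. word_dist G S (x n) (\<psi> n s \<otimes>\<^bsub>G\<^esub> x n) / d n < 1) \<omega>" if s: "s \<in> S" for s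
    proof -
      have "(\<lambda>n. \<psi> n s \<otimes>\<^bsub>G\<^esub> x n) \<in> A"
        using A(2)[of s] A(1) s SG x(1) by (auto simp: \<rho>_def)
      then have "((\<lambda>n. word_dist G S (x n) (\<psi> n s \<otimes>\<^bsub>G\<^esub> x n) / d n) \<longlongrightarrow> 0) \<omega>"
        using P.in_class_iff[of A A x] A(1) x(1) by (simp add: asymptotic_cone_def ultralimit_rel_def)
      then show ?thesis by (rule order_tendstoD) simp
    qed
    then have "eventually (\<lambda>n. \<forall>s\<in>S. word_dist G S (x n) (\<psi> n s \<otimes>\<^bsub>G\<^esub> x n) / d n < 1) \<omega>"
      using fin by (simp add: eventually_ball_finite)
    then obtain n where n: "\<And>s. s \<in> S \<Longrightarrow> word_dist G S (x n) (\<psi> n s \<otimes>\<^bsub>G\<^esub> x n) / d n < 1"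
      using eventually_happens'[OF P.not_bot] by blast
    (* Conjugating by the n-th entry of the fixed point gives a representative of too small energy. *)
    let ?f = "\<lambda>g\<in>carrier G. inv\<^bsub>G\<^esub> (x n) \<otimes>\<^bsub>G\<^esub> \<psi> n g \<otimes>\<^bsub>G\<^esub> inv\<^bsub>G\<^esub> (inv\<^bsub>G\<^esub> (x n))"
    have "energy G S (\<kappa> n) \<le> nat \<lfloor>d n\<rfloor>"
    proof (rule energy_le)
      show "?f \<in> \<kappa> n" using xc by (intro Out_class_conjugate[OF \<kappa>O \<psi>(1)]) simp
      fix s assume s: "s \<in> S"
      then have sG: "s \<in> carrier G" "\<psi> n s \<in> carrier G" using SG hom[of n] by (auto simp: hom_def)
      have "real (word_length G S (?f s)) = word_dist G S (x n) (\<psi> n s \<otimes>\<^bsub>G\<^esub> x n)"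
        using sG xc by (simp add: word_dist_def m_assoc)
      also have "\<dots> \<le> d n" using n[OF s] d[of n] by (simp add: pos_divide_less_eq)
      finally show "word_length G S (?f s) \<le> nat \<lfloor>d n\<rfloor>" by (rule le_nat_floor)
    qed
    then show False using \<kappa>(2)[of n] d[of n] by linarith
  qed
qed

end
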